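(* Let $\mathcal{C}$ be a class of set functions closed under truncation. If there is an $\alpha$-approximation algorithm for \textsc{Assignment} with processing speed functions from $\mathcal{C}$, then there is an $\lfloor \alpha \rfloor$-augmented $\alpha$-approximation algorithm for \textsc{Max-min Fair Allocation} with utility functions from $\mathcal{C}$.
   Context: \textsc{Assignment}: given finite sets $J$ (jobs) and $M$ (machines) and processing speed functions $g_j : 2^M \to \mathbb{R}_{\geq 0}$ (value oracle), with processing times $f_j(S) = 1/g_j(S)$, find an assignment $\mathbf{S} = (S_j)_{j\in J}$ of non-empty sets $S_j \subseteq M$ minimizing $L(\mathbf{S}) := \max_{i \in M} \sum_{j : i \in S_j} f_j(S_j)$; an $\alpha$-approximation algorithm computes in polynomial time an assignment of load at most $\alpha$ times the optimum. \textsc{Max-min Fair Allocation} (MMFA): given a finite item set $I$, a finite agent set $A$ and utilities $u_j : 2^I \to \mathbb{R}_{\geq 0}$ for $j \in A$, find $\mathbf{T} = (T_j)_{j \in A}$ with $T_j \subseteq I$ and $|\{j \in A : i \in T_j\}| \leq 1$ for all $i \in I$, maximizing $\min_{j \in A} u_j(T_j)$; let $V^*$ be the optimal value. A $\beta$-augmented $\alpha$-approximation algorithm for MMFA computes in polynomial time $\mathbf{T}$ with $\min_{j\in A} u_j(T_j) \geq V^*/\alpha$ and $|\{j \in A : i \in T_j\}| \leq \beta$ for all $i \in I$. A class $\mathcal{C}$ of set functions is closed under truncation if for every $h \in \mathcal{C}$ and $t \in \mathbb{R}_{\geq 0}$ the function $h^t(S) := \min\{h(S), t\}$ is in $\mathcal{C}$.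 *)

theory Defs
  imports
    Complex_Main
    "HOL-Library.FuncSet"
    "HOL-Library.Log_Nat"
    "HOL-Library.Nat_Bijection"
    "HOL-Library.Extended_Nonnegative_Real"
    "HOL-Computational_Algebra.Polynomial"
begin

section \<open>Random access machines with oracles\<close>

text \<open>
  The model of computation is the random access machine with logarithmic cost, programmed in a
  structured language. Memory cells are addressed by, and contain, natural numbers of unbounded
  size; every number that is read or computed is charged its binary length, so that running times
  agree with those of Turing machines with oracles up to a polynomial.
\<close>

type_synonym memory = "nat \<Rightarrow> nat"

datatype aexp =
    Const nat
  | Mem aexp
  | Add aexp aexp
  | Sub aexp aexp
  | Mul aexp aexp
  | Div aexp aexp

fun aval :: "aexp \<Rightarrow> memory \<Rightarrow> nat" where
  "aval (Const k) s = k"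
| "aval (Mem a) s = s (aval a s)"
| "aval (Add a b) s = aval a s + aval b s"
| "aval (Sub a b) s = aval a s - aval b s"
| "aval (Mul a b) s = aval a s * aval b s"
| "aval (Div a b) s = aval a s div aval b s"

abbreviation bit_length :: "nat \<Rightarrow> nat" where
  "bit_length x \<equiv> floorlog 2 x"

fun acost :: "aexp \<Rightarrow> memory \<Rightarrow> nat" where
  "acost (Const k) s = 1 + bit_length k"
| "acost (Mem a) s = 1 + acost a s + bit_length (aval (Mem a) s)"
| "acost (Add a b) s = 1 + acost a s + acost b s + bit_length (aval (Add a b) s)"
| "acost (Sub a b) s = 1 + acost a s + acost b s + bit_length (aval (Sub a b) s)"
| "acost (Mul a b) s = 1 + acost a s + acost b s + bit_length (aval (Mul a b) s)"
| "acost (Div a b) s = 1 + acost a s + acost b s + bit_length (aval (Div a b) s)"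

datatype com =
    Skip
  | Assign aexp aexp
  | Query aexp aexp aexp
  | Seq com com
  | If aexp com com
  | While aexp com

text \<open>
  Queries to oracles consist of two numbers, and so do the answers. \<open>Query d a b\<close> submits the values
  of \<open>a\<close> and \<open>b\<close> and stores the answer in the two cells starting at the address \<open>d\<close>.
  Conditions hold iff their value is nonzero.
\<close>

type_synonym oracle_fun = "nat \<Rightarrow> nat \<Rightarrow> nat \<times> nat"

text \<open>
  \<open>exec \<Omega> c s t s'\<close>: with queries answered by \<open>\<Omega>\<close>, started in memory \<open>s\<close>, the program \<open>c\<close> halts after time \<open>t\<close>
  with memory \<open>s'\<close>.
\<close>

inductive exec :: "oracle_fun \<Rightarrow> com \<Rightarrow> memory \<Rightarrow> nat \<Rightarrow> memory \<Rightarrow> bool" for \<Omega> :: oracle_fun where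
  Skip: "exec \<Omega> Skip s 1 s"
| Assign: "exec \<Omega> (Assign d a) s (1 + acost d s + acost a s) (s(aval d s := aval a s))"
| Query: "\<Omega> (aval a s) (aval b s) = (x, y) \<Longrightarrow>
    exec \<Omega> (Query d a b) s
      (1 + acost d s + acost a s + acost b s + bit_length x + bit_length y)
      (s(aval d s := x, aval d s + 1 := y))"
| Seq: "exec \<Omega> c\<^sub>1 s t\<^sub>1 s' \<Longrightarrow> exec \<Omega> c\<^sub>2 s' t\<^sub>2 s'' \<Longrightarrow> exec \<Omega> (Seq c\<^sub>1 c\<^sub>2) s (1 + t\<^sub>1 + t\<^sub>2) s''"
| IfTrue: "aval a s \<noteq> 0 \<Longrightarrow> exec \<Omega> c\<^sub>1 s t s' \<Longrightarrow> exec \<Omega> (If a c\<^sub>1 c\<^sub>2) s (1 + acost a s + t) s'"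
| IfFalse: "aval a s = 0 \<Longrightarrow> exec \<Omega> c\<^sub>2 s t s' \<Longrightarrow> exec \<Omega> (If a c\<^sub>1 c\<^sub>2) s (1 + acost a s + t) s'"
| WhileTrue: "aval a s \<noteq> 0 \<Longrightarrow> exec \<Omega> c s t\<^sub>1 s' \<Longrightarrow> exec \<Omega> (While a c) s' t\<^sub>2 s'' \<Longrightarrow>
    exec \<Omega> (While a c) s (1 + acost a s + t\<^sub>1 + t\<^sub>2) s''"
| WhileFalse: "aval a s = 0 \<Longrightarrow> exec \<Omega> (While a c) s (1 + acost a s) s"

lemma exec_deterministic:
  "exec \<Omega> c s t s' \<Longrightarrow> exec \<Omega> c s u s'' \<Longrightarrow> u = t \<and> s'' = s'"
proof (induction arbitrary: u s'' rule: exec.induct)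
  case (Skip s)
  from Skip.prems show ?case by cases simp_all
next
  case (Assign d a s)
  from Assign.prems show ?case by cases simp_all
next
  case (Query a s b x y d)
  from Query.prems Query.hyps show ?case by cases simp_all
next
  case (Seq c\<^sub>1 s t\<^sub>1 s' c\<^sub>2 t\<^sub>2 s\<^sub>2)
  from Seq.prems show ?case by cases (metis Seq.IH)
next
  case (IfTrue a s c\<^sub>1 t s' c\<^sub>2)
  from IfTrue.prems IfTrue.hyps show ?case by cases (simp_all add: IfTrue.IH)
next
  case (IfFalse a s c\<^sub>2 t s' c\<^sub>1)
  from IfFalse.prems IfFalse.hyps show ?case by cases (simp_all add: IfFalse.IH)
next
  case (WhileTrue a s c t\<^sub>1 s' t\<^sub>2 s\<^sub>2)
  from WhileTrue.prems show ?case
  proof cases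
    case (WhileTrue u\<^sub>1 r u\<^sub>2)
    then show ?thesis by (metis WhileTrue.IH)
  next
    case WhileFalse
    then show ?thesis using WhileTrue.hyps(1) by blast
  qed
next
  case (WhileFalse a s c)
  from WhileFalse.prems WhileFalse.hyps show ?case by cases simp_all
qed


section \<open>Classes of set functions and value oracles\<close>

text \<open>
  Finite sets are presented to algorithms as initial segments of the naturals. A class of set
  functions is a family \<open>C\<close> where \<open>C m\<close> consists of the members with ground set \<open>{..<m}\<close>. Only
  values on subsets of the ground set are ever used.
\<close>

type_synonym set_class = "nat \<Rightarrow> (nat set \<Rightarrow> real) set"

definition nonneg_class :: "set_class \<Rightarrow> bool" where
  "nonneg_class C \<longleftrightarrow> (\<forall>m. \<forall>h \<in> C m. \<forall>S \<subseteq> {..<m}. 0 \<le> h S)"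

definition truncation :: "(nat set \<Rightarrow> real) \<Rightarrow> real \<Rightarrow> nat set \<Rightarrow> real" where
  "truncation h t = (\<lambda>S. min (h S) t)"

definition closed_under_truncation :: "set_class \<Rightarrow> bool" where
  "closed_under_truncation C \<longleftrightarrow> (\<forall>m. \<forall>h \<in> C m. \<forall>t \<ge> 0. truncation h t \<in> C m)"

text \<open>Numerator and denominator, in lowest terms, of a nonnegative rational number.\<close>

definition fraction_of :: "real \<Rightarrow> nat \<times> nat" where
  "fraction_of x = map_prod nat nat (quotient_of (the_inv real_of_rat x))"

definition encoding_length :: "real \<Rightarrow> nat" where
  "encoding_length x = bit_length (fst (fraction_of x)) + bit_length (snd (fraction_of x))"

text \<open>
  The function \<open>value_oracle n m h\<close> answers value queries for \<open>h 0, \<dots>, h (n - 1)\<close>, set functions on \<open>{..<m}\<close>. Sets are encoded by their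
  characteristic bit vectors (\<open>set_decode\<close>); queries outside the domain are answered by \<open>0\<close>.
\<close>

definition value_oracle :: "nat \<Rightarrow> nat \<Rightarrow> (nat \<Rightarrow> nat set \<Rightarrow> real) \<Rightarrow> oracle_fun" where
  "value_oracle n m h = (\<lambda>j x.
     if j < n \<and> set_decode x \<subseteq> {..<m} then fraction_of (h j (set_decode x)) else (0, 1))"

text \<open>
  An instance is given by \<open>n\<close>, \<open>m\<close>, \<open>value_oracle\<close>, and an upper bound \<open>b\<close> on the encoding
  lengths of the function values (the usual convention for oracles returning numbers); the size of
  the instance is \<open>n + m + b\<close>. Values have to be rational in order to be returned as answers.
\<close>

definition is_instance ::
    "set_class \<Rightarrow> nat \<Rightarrow> nat \<Rightarrow> nat \<Rightarrow> (nat \<Rightarrow> nat set \<Rightarrow> real) \<Rightarrow> bool" where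
  "is_instance C n m b h \<longleftrightarrow>
     (\<forall>j<n. h j \<in> C m \<and> (\<forall>S \<subseteq> {..<m}. h j S \<in> \<rat> \<and> encoding_length (h j S) \<le> b))"

definition initial_memory :: "nat \<Rightarrow> nat \<Rightarrow> nat \<Rightarrow> memory" where
  "initial_memory n m b = (\<lambda>_. 0)(0 := n, 1 := m, 2 := b)"

text \<open>The output is a family of sets indexed by \<open>{..<n}\<close>, the \<open>j\<close>-th of which is read off cell \<open>j\<close>.\<close>

definition output_family :: "memory \<Rightarrow> nat \<Rightarrow> nat set" where
  "output_family s = (\<lambda>j. set_decode (s j))"


section \<open>Assignment\<close>

definition assignments :: "nat \<Rightarrow> nat \<Rightarrow> (nat \<Rightarrow> nat set) set" where
  "assignments n m = {..<n} \<rightarrow> {S. S \<subseteq> {..<m} \<and> S \<noteq> {}}"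

text \<open>Extended arithmetic, so that a set of speed \<open>0\<close> has processing time \<open>\<infinity>\<close>.\<close>

definition processing_time :: "(nat set \<Rightarrow> real) \<Rightarrow> nat set \<Rightarrow> ennreal" where
  "processing_time g S = 1 / ennreal (g S)"

definition load ::
    "nat \<Rightarrow> nat \<Rightarrow> (nat \<Rightarrow> nat set \<Rightarrow> real) \<Rightarrow> (nat \<Rightarrow> nat set) \<Rightarrow> ennreal" where
  "load n m g S = Max ((\<lambda>i. \<Sum>j | j < n \<and> i \<in> S j. processing_time (g j) (S j)) ` {..<m})"

definition optimal_load :: "nat \<Rightarrow> nat \<Rightarrow> (nat \<Rightarrow> nat set \<Rightarrow> real) \<Rightarrow> ennreal" where
  "optimal_load n m g = (INF S \<in> assignments n m. load n m g S)"

definition assignment_approx_algorithm :: "set_class \<Rightarrow> real \<Rightarrow> com \<Rightarrow> bool" where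
  "assignment_approx_algorithm C \<alpha> c \<longleftrightarrow>
     (\<exists>p :: nat poly. \<forall>n m b g. 0 < m \<longrightarrow> is_instance C n m b g \<longrightarrow>
       (\<exists>t s. exec (value_oracle n m g) c (initial_memory n m b) t s \<and>
          t \<le> poly p (n + m + b) \<and>
          output_family s \<in> assignments n m \<and>
          load n m g (output_family s) \<le> ennreal \<alpha> * optimal_load n m g))"


section \<open>Max-min fair allocation\<close>

definition augmented_allocations :: "nat \<Rightarrow> nat \<Rightarrow> nat \<Rightarrow> (nat \<Rightarrow> nat set) set" where
  "augmented_allocations \<beta> n m =
     {T \<in> {..<n} \<rightarrow> Pow {..<m}. \<forall>i<m. card {j. j < n \<and> i \<in> T j} \<le> \<beta>}"

abbreviation allocations :: "nat \<Rightarrow> nat \<Rightarrow> (nat \<Rightarrow> nat set) set" where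
  "allocations n m \<equiv> augmented_allocations 1 n m"

definition min_utility ::
    "nat \<Rightarrow> (nat \<Rightarrow> nat set \<Rightarrow> real) \<Rightarrow> (nat \<Rightarrow> nat set) \<Rightarrow> real" where
  "min_utility n u T = Min ((\<lambda>j. u j (T j)) ` {..<n})"

definition optimal_utility :: "nat \<Rightarrow> nat \<Rightarrow> (nat \<Rightarrow> nat set \<Rightarrow> real) \<Rightarrow> real" where
  "optimal_utility n m u = (SUP T \<in> allocations n m. min_utility n u T)"

definition mmfa_augmented_approx_algorithm ::
    "set_class \<Rightarrow> nat \<Rightarrow> real \<Rightarrow> com \<Rightarrow> bool" where
  "mmfa_augmented_approx_algorithm C \<beta> \<alpha> c \<longleftrightarrow>
     (\<exists>p :: nat poly. \<forall>n m b u. 0 < n \<longrightarrow> is_instance C n m b u \<longrightarrow>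
       (\<exists>t s. exec (value_oracle n m u) c (initial_memory n m b) t s \<and>
          t \<le> poly p (n + m + b) \<and>
          output_family s \<in> augmented_allocations \<beta> n m \<and>
          min_utility n u (output_family s) \<ge> optimal_utility n m u / \<alpha>))"

end

theory Submission
  imports Defs
begin

text \<open>
  Truncate the utilities at a level \<open>V\<close> and run the assignment algorithm on them. If the optimum \<open>x\<close> of the
  allocation problem is at most \<open>V\<close>, an optimal allocation has load at most \<open>1 / x\<close>, so the computed assignment
  has load at most \<open>\<alpha> / x\<close>: every agent receives at least \<open>x / \<alpha>\<close>, and as every job takes time at least \<open>1 / V\<close>,
  every item is used at most \<open>\<alpha> V / x\<close> times. This is less than \<open>\<lfloor>\<alpha>\<rfloor> + 1\<close> as soon as \<open>V / x < (K + 1) / K\<close> for a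
  constant \<open>K\<close>, so a geometric grid of polynomially many levels suffices. It is only tested whether no item is used more
  than \<open>\<lfloor>\<alpha>\<rfloor>\<close> times, and the best of the allocations passing this test is returned; in particular
  \<open>\<alpha>\<close> itself, which need not be computable, is not used by the program.

  Assignments consist of non-empty sets, whereas an allocation may leave an agent without items. Therefore the agents whose value for the
  empty set is at least \<open>V\<close> are removed first, and these values are added to the levels, so that the smallest level that
  is at least \<open>x\<close> removes exactly the agents for which the empty set is worth at least \<open>x\<close>.
\<close>

section \<open>Time bounds for random access machine programs\<close>

text \<open>Two facts make the number of levels polynomial. A positive optimum is one of the values
  \<open>u j S\<close>, a fraction with numerator and denominator below 2 ^ b, so it lies between 1
  / 2 ^ b and 2 ^ b; and ((K + 1) / K) ^ K is at least 2, so \<open>K * b\<close> grid steps cover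
  each half of this range. No level has to be recognised as the right one: every truncated instance
  is a legal input, so each run halts in time with an assignment, and the load guarantee is
  exploited for one level only. The obstacle is that the given algorithm is an arbitrary machine
  program that expects an otherwise empty memory. Running it many times inside one memory requires
  fresh cells for each run, an oracle that answers for the truncated jobs, and, as the cost is
  logarithmic, control over the length of all numbers. The truncation level may itself be an oracle
  answer, so it has to be available in lowest terms and with known length; hence a grid of explicit
  powers.\<close>

definition fits :: "nat \<Rightarrow> nat \<Rightarrow> bool" where
  "fits B x \<longleftrightarrow> x < 2 ^ B"

lemma fits_if_le [simp]: "x \<le> B \<Longrightarrow> fits B x"
  unfolding fits_def by (rule le_less_trans[OF _ less_exp])

lemma fits_mono: "fits B x \<Longrightarrow> B \<le> B' \<Longrightarrow> fits B' x"
  unfolding fits_def by (erule less_le_trans) simp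

lemma fits_le: "fits B x \<Longrightarrow> y \<le> x \<Longrightarrow> fits B y"
  unfolding fits_def by simp

lemma bit_length_le_iff: "bit_length x \<le> B \<longleftrightarrow> fits B x"
  by (simp add: floorlog_le_iff fits_def)

lemma fits_bit_length: "fits (bit_length x) x"
  by (simp add: bit_length_le_iff[symmetric])

text \<open>Only constants and cell contents are bounded. Intermediate values need no hypothesis:
  sums and products at most add up the lengths of their operands, so a value has at most
  \<open>leaves e * B\<close> bits. A \<open>Mem\<close> counts as one leaf because its value is
  again a cell content.\<close>

fun reads_fit :: "nat \<Rightarrow> aexp \<Rightarrow> memory \<Rightarrow> bool" where
  "reads_fit B (Const k) s \<longleftrightarrow> fits B k"
| "reads_fit B (Mem a) s \<longleftrightarrow> reads_fit B a s \<and> fits B (s (aval a s))"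
| "reads_fit B (Add a b) s \<longleftrightarrow> reads_fit B a s \<and> reads_fit B b s"
| "reads_fit B (Sub a b) s \<longleftrightarrow> reads_fit B a s \<and> reads_fit B b s"
| "reads_fit B (Mul a b) s \<longleftrightarrow> reads_fit B a s \<and> reads_fit B b s"
| "reads_fit B (Div a b) s \<longleftrightarrow> reads_fit B a s \<and> reads_fit B b s"

fun leaves :: "aexp \<Rightarrow> nat" where
  "leaves (Const k) = 1"
| "leaves (Mem a) = 1"
| "leaves (Add a b) = leaves a + leaves b"
| "leaves (Sub a b) = leaves a + leaves b"
| "leaves (Mul a b) = leaves a + leaves b"
| "leaves (Div a b) = leaves a + leaves b"

fun aweight :: "aexp \<Rightarrow> nat" where
  "aweight (Const k) = 1"
| "aweight (Mem a) = 1 + aweight a"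
| "aweight (Add a b) = 1 + aweight a + aweight b + leaves (Add a b)"
| "aweight (Sub a b) = 1 + aweight a + aweight b + leaves (Sub a b)"
| "aweight (Mul a b) = 1 + aweight a + aweight b + leaves (Mul a b)"
| "aweight (Div a b) = 1 + aweight a + aweight b + leaves (Div a b)"

lemma leaves_pos: "1 \<le> leaves e"
  by (induction e) auto

lemma fits_add: "fits p x \<Longrightarrow> fits q y \<Longrightarrow> 1 \<le> p \<Longrightarrow> 1 \<le> q \<Longrightarrow> fits (p + q) (x + y)"
proof -
  assume a: "fits p x" "fits q y" "1 \<le> p" "1 \<le> q"
  have "(2::nat) ^ p \<ge> 2 ^ 1" "(2::nat) ^ q \<ge> 2 ^ 1"
    using a by (intro power_increasing; simp)+
  then obtain c d where cd: "(2::nat) ^ p = 2 + c" "(2::nat) ^ q = 2 + d"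
    by (metis le_Suc_ex power_one_right)
  \<comment> \<open>For two numbers of size at least 2 the sum does not exceed the product.\<close>
  have "(2::nat) ^ p + 2 ^ q \<le> 2 ^ p * 2 ^ q"
    unfolding cd by (simp add: algebra_simps)
  then show ?thesis using a by (auto simp: fits_def power_add)
qed

lemma fits_mult: "fits p x \<Longrightarrow> fits q y \<Longrightarrow> fits (p + q) (x * y)"
  unfolding fits_def power_add by (rule mult_strict_mono) auto

lemma aval_fits: "reads_fit B e s \<Longrightarrow> 1 \<le> B \<Longrightarrow> fits (leaves e * B) (aval e s)"
proof (induction e)
  case (Add a b)
  have "1 \<le> leaves a * B" "1 \<le> leaves b * B"
    using Add.prems leaves_pos[of a] leaves_pos[of b] by (simp_all add: Suc_le_eq)
  then show ?case using Add by (simp add: fits_add add_mult_distrib)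
next
  case (Sub a b)
  then have "fits (leaves a * B) (aval a s)" by simp
  then have "fits (leaves a * B) (aval (Sub a b) s)" by (rule fits_le) (simp add: div_le_dividend)
  then show ?case by (rule fits_mono) (simp add: add_mult_distrib)
next
  case (Mul a b)
  then show ?case by (simp add: fits_mult add_mult_distrib)
next
  case (Div a b)
  then have "fits (leaves a * B) (aval a s)" by simp
  then have "fits (leaves a * B) (aval (Div a b) s)" by (rule fits_le) (simp add: div_le_dividend)
  then show ?case by (rule fits_mono) (simp add: add_mult_distrib)
qed simp_all

lemma acost_le:
  assumes "reads_fit B e s" "1 \<le> B"
  shows "acost e s \<le> aweight e * (B + 1)"
proof -
  have bin: "1 + c1 + c2 + l \<le> (1 + w1 + w2 + k) * (B + 1)"
    if "c1 \<le> w1 * (B + 1)" "c2 \<le> w2 * (B + 1)" "l \<le> k * B" for c1 c2 l w1 w2 k :: nat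
    using that by (simp add: algebra_simps)
  have bl: "bit_length (aval e s) \<le> leaves e * B" if "reads_fit B e s" for e
    unfolding bit_length_le_iff using that assms(2) by (rule aval_fits)
  show ?thesis using assms(1)
  proof (induction e)
    case (Add a b)
    with bl[OF Add.prems] show ?case by (simp only: acost.simps aweight.simps reads_fit.simps) (intro bin; simp)
  next
    case (Sub a b)
    with bl[OF Sub.prems] show ?case by (simp only: acost.simps aweight.simps reads_fit.simps) (intro bin; simp)
  next
    case (Mul a b)
    with bl[OF Mul.prems] show ?case by (simp only: acost.simps aweight.simps reads_fit.simps) (intro bin; simp)
  next
    case (Div a b)
    with bl[OF Div.prems] show ?case by (simp only: acost.simps aweight.simps reads_fit.simps) (intro bin; simp)
  qed (auto simp: bit_length_le_iff[symmetric])
qed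

section \<open>Timed correctness rules for programs\<close>

fun cweight :: "com \<Rightarrow> nat" where
  "cweight Skip = 1"
| "cweight (Assign d a) = 1 + aweight d + aweight a"
| "cweight (Query d a b) = 3 + aweight d + aweight a + aweight b"
| "cweight (Seq c d) = 1 + cweight c + cweight d"
| "cweight (If a c d) = 1 + aweight a + cweight c + cweight d"
| "cweight (While a c) = 1 + aweight a + cweight c"

text \<open>Since \<open>exec\<close> is deterministic, the existence of one halting run within time
  T already is total correctness with a time bound.\<close>

definition runs :: "oracle_fun \<Rightarrow> com \<Rightarrow> memory \<Rightarrow> nat \<Rightarrow> (memory \<Rightarrow> bool) \<Rightarrow> bool" where
  "runs \<Omega> c s T Q \<longleftrightarrow> (\<exists>t s'. exec \<Omega> c s t s' \<and> t \<le> T \<and> Q s')"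

lemma runsI: "exec \<Omega> c s t s' \<Longrightarrow> t \<le> T \<Longrightarrow> Q s' \<Longrightarrow> runs \<Omega> c s T Q"
  unfolding runs_def by blast

lemma runs_mono: "runs \<Omega> c s T Q \<Longrightarrow> T \<le> T' \<Longrightarrow> (\<And>s'. Q s' \<Longrightarrow> Q' s') \<Longrightarrow> runs \<Omega> c s T' Q'"
  unfolding runs_def by (meson order_trans)

lemma runs_Seq:
  assumes "runs \<Omega> c s T Q" "\<And>s'. Q s' \<Longrightarrow> runs \<Omega> c' s' T' Q'"
  shows "runs \<Omega> (Seq c c') s (1 + T + T') Q'"
proof -
  from assms(1) obtain t s' where 1: "exec \<Omega> c s t s'" "t \<le> T" "Q s'" unfolding runs_def by blast
  from assms(2)[OF 1(3)] obtain t' s'' where 2: "exec \<Omega> c' s' t' s''" "t' \<le> T'" "Q' s''"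
    unfolding runs_def by blast
  show ?thesis by (rule runsI[OF exec.Seq[OF 1(1) 2(1)]]) (use 1 2 in auto)
qed

text \<open>The loops treated this way have a number of rounds fixed beforehand, so an invariant
  indexed by the round replaces a termination measure. The factor \<open>N + 1\<close> pays for the
  failing test at the end.\<close>

lemma runs_While:
  assumes inv: "I 0 s"
    and cond: "\<And>i s. I i s \<Longrightarrow> i \<le> N \<Longrightarrow> reads_fit B a s \<and> (aval a s \<noteq> 0 \<longleftrightarrow> i < N)"
    and body: "\<And>i s. I i s \<Longrightarrow> i < N \<Longrightarrow> runs \<Omega> c s T (I (Suc i))"
    and "1 \<le> B"
  shows "runs \<Omega> (While a c) s ((N + 1) * (1 + aweight a * (B + 1) + T)) (I N)"
proof -
  have "runs \<Omega> (While a c) s ((k + 1) * (1 + aweight a * (B + 1) + T)) (I N)"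
    if "I i s" "i + k = N" for i k s
    using that
  proof (induction k arbitrary: i s)
    case 0
    have "acost a s \<le> aweight a * (B + 1)" using cond[of i s] 0 assms(4) acost_le by auto
    then show ?case using cond[of i s] 0 by (intro runsI[OF exec.WhileFalse]) auto
  next
    case (Suc k)
    have c: "acost a s \<le> aweight a * (B + 1)" "aval a s \<noteq> 0"
      using cond[of i s] Suc assms(4) acost_le by auto
    obtain t s' where 1: "exec \<Omega> c s t s'" "t \<le> T" "I (Suc i) s'"
      using body[of i s] Suc.prems unfolding runs_def by auto
    obtain t' s'' where 2: "exec \<Omega> (While a c) s' t' s''"
      "t' \<le> (k + 1) * (1 + aweight a * (B + 1) + T)" "I N s''"
      using Suc.IH[OF 1(3)] Suc.prems unfolding runs_def by auto
    have "1 + acost a s + t + t' \<le> 1 + aweight a * (B + 1) + T + (k + 1) * (1 + aweight a * (B + 1) + T)"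
      using c 1(2) 2(2) by linarith
    also have "\<dots> = (Suc k + 1) * (1 + aweight a * (B + 1) + T)" by simp
    finally show ?case by (intro runsI[OF exec.WhileTrue[OF c(2) 1(1) 2(1)]]) (use 2 in auto)
  qed
  from this[of 0 s N] inv show ?thesis by simp
qed

text \<open>A weakest precondition that also demands that every number read fits into B bits, so
  that one symbolic evaluation yields both correctness and the time bound. It serves loop-free
  blocks only; loops are left to \<open>runs_While\<close>, and \<open>False\<close> makes the claim
  for them vacuous.\<close>

fun wp :: "oracle_fun \<Rightarrow> nat \<Rightarrow> com \<Rightarrow> (memory \<Rightarrow> bool) \<Rightarrow> memory \<Rightarrow> bool" where
  "wp \<Omega> B Skip Q s \<longleftrightarrow> Q s"
| "wp \<Omega> B (Assign d a) Q s \<longleftrightarrow> reads_fit B d s \<and> reads_fit B a s \<and> Q (s(aval d s := aval a s))"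
| "wp \<Omega> B (Query d a b) Q s \<longleftrightarrow> reads_fit B d s \<and> reads_fit B a s \<and> reads_fit B b s \<and>
     fits B (fst (\<Omega> (aval a s) (aval b s))) \<and> fits B (snd (\<Omega> (aval a s) (aval b s))) \<and>
     Q (s(aval d s := fst (\<Omega> (aval a s) (aval b s)), aval d s + 1 := snd (\<Omega> (aval a s) (aval b s))))"
| "wp \<Omega> B (Seq c c') Q s \<longleftrightarrow> wp \<Omega> B c (wp \<Omega> B c' Q) s"
| "wp \<Omega> B (If a c c') Q s \<longleftrightarrow> reads_fit B a s \<and>
     (aval a s \<noteq> 0 \<longrightarrow> wp \<Omega> B c Q s) \<and> (aval a s = 0 \<longrightarrow> wp \<Omega> B c' Q s)"
| "wp \<Omega> B (While a c) Q s \<longleftrightarrow> False"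

lemma runs_wp:
  assumes "wp \<Omega> B c Q s" "1 \<le> B"
  shows "runs \<Omega> c s (cweight c * (B + 1)) Q"
  using assms(1)
proof (induction c arbitrary: Q s)
  case Skip
  then show ?case by (intro runsI[OF exec.Skip]) auto
next
  case (Assign d a)
  then have "acost d s \<le> aweight d * (B + 1)" "acost a s \<le> aweight a * (B + 1)"
    using assms(2) acost_le by auto
  then have "1 + acost d s + acost a s \<le> cweight (Assign d a) * (B + 1)"
    by (simp add: algebra_simps)
  then show ?case by (rule runsI[OF exec.Assign]) (use Assign in \<open>simp add: fun_upd_def\<close>)
next
  case (Query d a b)
  obtain x y where xy: "\<Omega> (aval a s) (aval b s) = (x, y)" by fastforce
  have "acost d s \<le> aweight d * (B + 1)" "acost a s \<le> aweight a * (B + 1)"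
    "acost b s \<le> aweight b * (B + 1)" "bit_length x \<le> B" "bit_length y \<le> B"
    using Query xy assms(2) acost_le by (auto simp: bit_length_le_iff)
  then have "1 + acost d s + acost a s + acost b s + bit_length x + bit_length y
      \<le> cweight (Query d a b) * (B + 1)"
    by (simp add: algebra_simps)
  then show ?case by (rule runsI[OF exec.Query[of \<Omega> a s b x y d, OF xy]]) (use Query xy in \<open>simp add: fun_upd_def\<close>)
next
  case (Seq c c')
  then have "runs \<Omega> c s (cweight c * (B + 1)) (wp \<Omega> B c' Q)" by simp
  from runs_Seq[OF this Seq.IH(2)] show ?case
    by (rule runs_mono) (auto simp: algebra_simps)
next
  case (If a c c')
  then have c: "acost a s \<le> aweight a * (B + 1)" using assms(2) acost_le by auto
  show ?case
  proof (cases "aval a s = 0")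
    case True
    then have "runs \<Omega> c' s (cweight c' * (B + 1)) Q" using If by simp
    then obtain t s' where 1: "exec \<Omega> c' s t s'" "t \<le> cweight c' * (B + 1)" "Q s'"
      unfolding runs_def by blast
    have "1 + acost a s + t \<le> cweight (If a c c') * (B + 1)"
      using c 1(2) by (simp add: algebra_simps)
    then show ?thesis by (rule runsI[OF exec.IfFalse[OF True 1(1)]]) (rule 1(3))
  next
    case False
    then have "runs \<Omega> c s (cweight c * (B + 1)) Q" using If by simp
    then obtain t s' where 1: "exec \<Omega> c s t s'" "t \<le> cweight c * (B + 1)" "Q s'"
      unfolding runs_def by blast
    have "1 + acost a s + t \<le> cweight (If a c c') * (B + 1)"
      using c 1(2) by (simp add: algebra_simps)
    then show ?thesis by (rule runsI[OF exec.IfTrue[OF False 1(1)]]) (rule 1(3))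
  qed
qed simp

section \<open>Truncation levels and the induced allocation\<close>

lemma fraction_of_eqI:
  assumes "x = real p / real q" "0 < q" "coprime p q"
  shows "fraction_of x = (p, q)"
proof -
  have "x = real_of_rat (Fract (int p) (int q))"
    using assms by (simp add: of_rat_rat)
  then have "the_inv real_of_rat x = Fract (int p) (int q)"
    by (simp add: the_inv_f_f inj_def)
  moreover have "quotient_of (Fract (int p) (int q)) = (int p, int q)"
    using assms by (simp add: quotient_of_Fract normalize_stable)
  ultimately show ?thesis by (simp add: fraction_of_def)
qed

lemma fraction_of_cases:
  assumes "x \<in> \<rat>" "0 \<le> x"
  obtains p q where "fraction_of x = (p, q)" "x = real p / real q" "0 < q" "coprime p q"
proof -
  obtain r where r: "x = real_of_rat r" using assms(1) by (auto simp: Rats_def)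
  obtain a d where ad: "quotient_of r = (a, d)" by fastforce
  have d: "0 < d" using quotient_of_denom_pos[OF ad] .
  have ra: "r = rat_of_int a / rat_of_int d" using quotient_of_div[OF ad] .
  have "0 \<le> r" using assms(2) r by simp
  then have a: "0 \<le> a" using ra d by (simp add: zero_le_divide_iff)
  have "x = real (nat a) / real (nat d)" using r ra a d by (simp add: of_rat_divide)
  moreover have "coprime (nat a) (nat d)"
    using quotient_of_coprime[OF ad] a d by (metis coprime_int_iff int_nat_eq less_imp_le)
  moreover have "0 < nat d" using d by simp
  ultimately show ?thesis using that fraction_of_eqI by blast
qed

text \<open>Allocations are total functions, so there are infinitely many of them; but a minimum
  utility is one of the finitely many values \<open>u j S\<close>, so the supremum is a
  maximum.\<close>

lemma optimal_utility_attained: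
  assumes "0 < n"
  obtains T where "T \<in> allocations n m" "min_utility n u T = optimal_utility n m u"
proof -
  let ?X = "min_utility n u ` allocations n m"
  have "?X \<subseteq> (\<lambda>(j, S). u j S) ` ({..<n} \<times> Pow {..<m})"
  proof
    fix v assume "v \<in> ?X"
    then obtain T where T: "T \<in> allocations n m" "v = min_utility n u T" by blast
    have "min_utility n u T \<in> (\<lambda>j. u j (T j)) ` {..<n}"
      unfolding min_utility_def using assms by (intro Min_in) auto
    then show "v \<in> (\<lambda>(j, S). u j S) ` ({..<n} \<times> Pow {..<m})"
      using T by (force simp: augmented_allocations_def Pi_def)
  qed
  then have fin: "finite ?X" by (rule finite_subset) simp
  have "(\<lambda>_. {}) \<in> allocations n m" by (simp add: augmented_allocations_def)
  then have ne: "?X \<noteq> {}" by blast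
  have "optimal_utility n m u \<in> ?X"
    unfolding optimal_utility_def using fin ne by (metis Max_in cSup_eq_Max)
  then show ?thesis using that by auto
qed

lemma min_utility_ge_iff:
  assumes "0 < n"
  shows "v \<le> min_utility n u T \<longleftrightarrow> (\<forall>j<n. v \<le> u j (T j))"
  unfolding min_utility_def using assms by (subst Min_ge_iff) auto

text \<open>The jobs are the agents that are not removed, in increasing order; \<open>rank\<close> is the index of an agent as a job.\<close>

definition active_list :: "(nat \<Rightarrow> nat set \<Rightarrow> real) \<Rightarrow> real \<Rightarrow> nat \<Rightarrow> nat list" where
  "active_list u V j = filter (\<lambda>i. u i {} < V) [0..<j]"

definition rank :: "(nat \<Rightarrow> nat set \<Rightarrow> real) \<Rightarrow> real \<Rightarrow> nat \<Rightarrow> nat" where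
  "rank u V j = length (active_list u V j)"

definition speeds :: "nat \<Rightarrow> (nat \<Rightarrow> nat set \<Rightarrow> real) \<Rightarrow> real \<Rightarrow> nat \<Rightarrow> nat set \<Rightarrow> real" where
  "speeds n u V = (\<lambda>i. truncation (u (active_list u V n ! i)) V)"

definition induced_allocation ::
    "(nat \<Rightarrow> nat set \<Rightarrow> real) \<Rightarrow> real \<Rightarrow> (nat \<Rightarrow> nat set) \<Rightarrow> nat \<Rightarrow> nat set" where
  "induced_allocation u V S j = (if u j {} < V then S (rank u V j) else {})"

lemma rank_0 [simp]: "rank u V 0 = 0"
  by (simp add: rank_def active_list_def)

lemma rank_Suc [simp]: "rank u V (Suc j) = (if u j {} < V then Suc (rank u V j) else rank u V j)"
  by (simp add: rank_def active_list_def)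

lemma active_list_Suc:
  "active_list u V (Suc j) = (if u j {} < V then active_list u V j @ [j] else active_list u V j)"
  by (simp add: active_list_def)

lemma rank_le: "rank u V j \<le> j"
  unfolding rank_def active_list_def by (rule order_trans[OF length_filter_le]) simp

lemma active_list_nth:
  assumes "i < rank u V n"
  shows "active_list u V n ! i < n" "u (active_list u V n ! i) {} < V"
    "rank u V (active_list u V n ! i) = i"
proof -
  have "active_list u V n ! i \<in> set (active_list u V n)"
    using assms by (simp add: rank_def)
  then show "active_list u V n ! i < n" "u (active_list u V n ! i) {} < V"
    by (auto simp: active_list_def)
  show "rank u V (active_list u V n ! i) = i"
    using assms
  proof (induction n)
    case (Suc n)
    show ?case
    proof (cases "i < rank u V n")
      case True
      with Suc.IH show ?thesis by (simp add: active_list_Suc nth_append rank_def)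
    next
      case False
      with Suc.prems have "u n {} < V" "i = rank u V n" by (auto split: if_splits)
      then show ?thesis by (simp add: active_list_Suc nth_append rank_def)
    qed
  qed simp
qed

lemma active_list_rank:
  assumes "j < n" "u j {} < V"
  shows "rank u V j < rank u V n" "active_list u V n ! rank u V j = j"
proof -
  have "rank u V j < rank u V n \<and> active_list u V n ! rank u V j = j"
    using assms(1)
  proof (induction n)
    case (Suc n)
    then show ?case
      using assms(2) by (cases "j = n") (auto simp: active_list_Suc rank_def nth_append)
  qed simp
  then show "rank u V j < rank u V n" "active_list u V n ! rank u V j = j" by auto
qed

lemma bij_betw_active_list:
  "bij_betw (\<lambda>i. active_list u V n ! i) {..<rank u V n} {j. j < n \<and> u j {} < V}"
  by (rule bij_betwI[where g = "rank u V"]) (auto simp: active_list_nth active_list_rank)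

lemma card_induced_allocation:
  "card {j. j < n \<and> i \<in> induced_allocation u V S j} = card {k. k < rank u V n \<and> i \<in> S k}"
proof -
  have "bij_betw (\<lambda>k. active_list u V n ! k) {k. k < rank u V n \<and> i \<in> S k}
      {j. j < n \<and> i \<in> induced_allocation u V S j}"
    by (rule bij_betwI[where g = "rank u V"])
      (auto simp: active_list_nth active_list_rank induced_allocation_def split: if_splits)
  then show ?thesis by (rule bij_betw_same_card[symmetric])
qed

lemma induced_allocation_subset:
  assumes "S \<in> assignments (rank u V n) m" "j < n"
  shows "induced_allocation u V S j \<subseteq> {..<m}"
proof (cases "u j {} < V")
  case True
  with assms active_list_rank(1)[of j n u V] show ?thesis
    by (simp add: induced_allocation_def assignments_def Pi_iff)
qed (simp add: induced_allocation_def)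

lemma ennreal_divide_le_iff_real:
  assumes "0 \<le> g" "0 < r"
  shows "1 / ennreal g \<le> ennreal r \<longleftrightarrow> 1 / r \<le> g"
proof (cases "g = 0")
  case True
  then show ?thesis using assms
    by (simp add: ennreal_divide_zero top_unique not_le)
next
  case False
  then have "1 / ennreal g = ennreal (1 / g)"
    using assms by (metis divide_ennreal ennreal_1 less_eq_real_def zero_le_one)
  then show ?thesis using False assms by (simp add: field_simps)
qed

text \<open>V' plays the role of the optimum and V is the truncation level. The witness is T
  restricted to the remaining agents: by \<open>gap\<close> none of them values the empty set at V'
  or more, so their bundles are non-empty; each item serves at most one job, and that job takes time
  at most 1 / V', as truncating at V \<ge> V' leaves its speed at least V'.\<close>

lemma optimal_load_le:
  assumes V: "0 < V'" "V' \<le> V" and m: "0 < m"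
    and T: "T \<in> allocations n m" "\<And>j. j < n \<Longrightarrow> V' \<le> u j (T j)"
    and gap: "\<And>j. j < n \<Longrightarrow> u j {} < V \<Longrightarrow> u j {} < V'"
  shows "optimal_load (rank u V n) m (speeds n u V) \<le> ennreal (1 / V')"
proof -
  let ?n = "rank u V n" and ?a = "\<lambda>i. active_list u V n ! i"
  let ?S = "\<lambda>i. T (?a i)"
  have a: "?a i < n" "u (?a i) {} < V" if "i < ?n" for i
    using active_list_nth[OF that] by auto
  have "?S i \<noteq> {}" if "i < ?n" for i
    using a[OF that] T(2) gap by force
  then have S: "?S \<in> assignments ?n m"
    using T(1) a by (auto simp: assignments_def augmented_allocations_def Pi_def)
  have "load ?n m (speeds n u V) ?S \<le> ennreal (1 / V')"
    unfolding load_def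
  proof (subst Max_le_iff, goal_cases)
    case 3
    show ?case
    proof safe
      fix i assume i: "i < m"
      let ?J = "{j. j < ?n \<and> i \<in> ?S j}"
      have "card ?J \<le> card {j. j < n \<and> i \<in> T j}"
        by (rule card_inj_on_le[where f = ?a])
          (auto simp: a intro: inj_on_subset[OF bij_betw_imp_inj_on[OF bij_betw_active_list]])
      also have "\<dots> \<le> 1" using T(1) i by (simp add: augmented_allocations_def)
      finally have card: "card ?J \<le> 1" .
      have "(\<Sum>j\<in>?J. processing_time (speeds n u V j) (?S j)) \<le> (\<Sum>j\<in>?J. ennreal (1 / V'))"
      proof (rule sum_mono)
        fix j assume j: "j \<in> ?J"
        have "V' \<le> speeds n u V j (?S j)"
          using j a T(2) V by (simp add: speeds_def truncation_def)
        then show "processing_time (speeds n u V j) (?S j) \<le> ennreal (1 / V')"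
          unfolding processing_time_def using V
          by (subst ennreal_divide_le_iff_real) auto
      qed
      also have "\<dots> = of_nat (card ?J) * ennreal (1 / V')" by simp
      also have "\<dots> \<le> 1 * ennreal (1 / V')"
        using of_nat_mono[OF card, where 'a = ennreal] by (intro mult_right_mono) auto
      finally show "(\<Sum>j\<in>?J. processing_time (speeds n u V j) (?S j)) \<le> ennreal (1 / V')" by simp
    qed
  qed (use m in auto)
  then show ?thesis
    unfolding optimal_load_def using S by (meson INF_lower2)
qed

text \<open>The third condition on V says that the load bound \<alpha> / V', measured in units of
  the shortest possible time 1 / V, is below \<beta> + 1. Removed agents are content with nothing,
  since they value the empty set at V or more, hence at least at V' / \<alpha>.\<close>

lemma induced_allocation_approximates:
  fixes \<alpha> V V' :: real
  assumes V: "0 < V'" "V' \<le> V" "\<alpha> * V < (real \<beta> + 1) * V'"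
    and m: "0 < m" and \<alpha>: "1 \<le> \<alpha>"
    and nonneg: "\<And>j S. j < n \<Longrightarrow> S \<subseteq> {..<m} \<Longrightarrow> 0 \<le> u j S"
    and T: "T \<in> allocations n m" "\<And>j. j < n \<Longrightarrow> V' \<le> u j (T j)"
    and gap: "\<And>j. j < n \<Longrightarrow> u j {} < V \<Longrightarrow> u j {} < V'"
    and S: "S \<in> assignments (rank u V n) m"
      "load (rank u V n) m (speeds n u V) S
         \<le> ennreal \<alpha> * optimal_load (rank u V n) m (speeds n u V)"
  shows "induced_allocation u V S \<in> augmented_allocations \<beta> n m"
    and "\<And>j. j < n \<Longrightarrow> V' / \<alpha> \<le> u j (induced_allocation u V S j)"
proof -
  let ?n = "rank u V n" and ?g = "speeds n u V"
  have "load ?n m ?g S \<le> ennreal \<alpha> * ennreal (1 / V')"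
    using S(2) optimal_load_le[OF V(1,2) m T gap] by (meson mult_left_mono order_trans zero_le)
  also have "\<dots> = ennreal (\<alpha> / V')"
    using \<alpha> V by (subst ennreal_mult[symmetric]) auto
  finally have L: "load ?n m ?g S \<le> ennreal (\<alpha> / V')" .
  have L': "(\<Sum>j | j < ?n \<and> i \<in> S j. processing_time (?g j) (S j)) \<le> ennreal (\<alpha> / V')"
    if "i < m" for i
  proof -
    have "(\<Sum>j | j < ?n \<and> i \<in> S j. processing_time (?g j) (S j)) \<le> load ?n m ?g S"
      unfolding load_def using that by (intro Max_ge) auto
    then show ?thesis using L by simp
  qed
  have S_sub: "S j \<subseteq> {..<m}" "S j \<noteq> {}" if "j < ?n" for j
    using S(1) that by (auto simp: assignments_def Pi_def)
  have g_nonneg: "0 \<le> ?g j (S j)" if "j < ?n" for j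
    using S_sub[OF that] active_list_nth[OF that] nonneg V by (simp add: speeds_def truncation_def)
  have "card {k. k < ?n \<and> i \<in> S k} \<le> \<beta>" if i: "i < m" for i
  proof -
    let ?J = "{k. k < ?n \<and> i \<in> S k}"
    have "ennreal (real (card ?J) / V) = (\<Sum>j\<in>?J. ennreal (1 / V))"
      using V by (simp add: ennreal_of_nat_eq_real_of_nat flip: ennreal_mult)
    also have "\<dots> \<le> (\<Sum>j\<in>?J. processing_time (?g j) (S j))"
    proof (rule sum_mono)
      fix j assume "j \<in> ?J"
      then have g: "0 \<le> ?g j (S j)" "?g j (S j) \<le> V"
        using g_nonneg by (auto simp: speeds_def truncation_def)
      show "ennreal (1 / V) \<le> processing_time (?g j) (S j)"
      \<comment> \<open>Speed 0 means infinite time, for which the lower bound is trivial.\<close>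
      proof (cases "?g j (S j) = 0")
        case False
        then have "processing_time (?g j) (S j) = ennreal (1 / ?g j (S j))"
          unfolding processing_time_def using g
          by (metis divide_ennreal ennreal_1 less_eq_real_def zero_le_one)
        moreover have "1 / V \<le> 1 / ?g j (S j)" using False g V by (intro divide_left_mono) auto
        ultimately show ?thesis by (simp add: ennreal_leI)
      qed (simp add: processing_time_def)
    qed
    also have "\<dots> \<le> ennreal (\<alpha> / V')" using L'[OF i] .
    finally have "real (card ?J) / V \<le> \<alpha> / V'"
      using \<alpha> V by (subst (asm) ennreal_le_iff) auto
    then have "real (card ?J) * V' \<le> \<alpha> * V"
      using V by (simp add: field_simps)
    then have "real (card ?J) * V' < (real \<beta> + 1) * V'" using V by linarith
    \<comment> \<open>Strictness matters: a cardinality below \<beta> + 1 is at most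
      \<beta>.\<close>
    then have "real (card ?J) < real \<beta> + 1" using V by simp
    then show ?thesis by linarith
  qed
  then show "induced_allocation u V S \<in> augmented_allocations \<beta> n m"
    using induced_allocation_subset[OF S(1)]
    by (auto simp: augmented_allocations_def card_induced_allocation Pi_def)
  show "V' / \<alpha> \<le> u j (induced_allocation u V S j)" if j: "j < n" for j
  proof (cases "u j {} < V")
    case True
    let ?k = "rank u V j"
    have k: "?k < ?n" "active_list u V n ! ?k = j" using active_list_rank[of j n u V, OF j True] by auto
    \<comment> \<open>Non-emptiness of the sets in an assignment is used here: a job without
      machines would not show up in any load.\<close>
    obtain i where i: "i \<in> S ?k" "i < m" using S_sub[OF k(1)] by blast
    have "processing_time (?g ?k) (S ?k) \<le> (\<Sum>j | j < ?n \<and> i \<in> S j. processing_time (?g j) (S j))"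
      using i k by (intro member_le_sum) auto
    also have "\<dots> \<le> ennreal (\<alpha> / V')" using L'[OF i(2)] .
    finally have "1 / (\<alpha> / V') \<le> ?g ?k (S ?k)"
      unfolding processing_time_def using ennreal_divide_le_iff_real[OF g_nonneg[OF k(1)]] \<alpha> V by auto
    then show ?thesis using True k by (simp add: induced_allocation_def speeds_def truncation_def)
  next
    case False
    have "V' / \<alpha> \<le> V'" using \<alpha> V by (simp add: field_simps)
    then show ?thesis using False V by (simp add: induced_allocation_def)
  qed
qed

section \<open>A geometric grid of truncation levels\<close>

text \<open>
  The levels \<open>((K + 1) / K) ^ (L - i)\<close> for \<open>i = 0, 1, \<dots>, 2 * L\<close>, as fractions in lowest terms.
\<close>

definition grid :: "nat \<Rightarrow> nat \<Rightarrow> nat \<Rightarrow> nat \<times> nat" where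
  "grid K L i =
     (if i < L then ((K + 1) ^ (L - i), K ^ (L - i)) else (K ^ (i - L), (K + 1) ^ (i - L)))"

definition ratio :: "nat \<times> nat \<Rightarrow> real" where
  "ratio x = real (fst x) / real (snd x)"

lemma grid_lowest_terms: "coprime (fst (grid K L i)) (snd (grid K L i))"
  by (simp add: grid_def coprime_Suc_left_nat coprime_Suc_right_nat)

lemma grid_pos: "1 \<le> K \<Longrightarrow> 0 < fst (grid K L i) \<and> 0 < snd (grid K L i)"
  by (simp add: grid_def)

lemma grid_0: "grid K L 0 = ((K + 1) ^ L, K ^ L)"
  by (simp add: grid_def)

lemma grid_fits:
  assumes "i \<le> 2 * L + 1"
  shows "fits ((K + 1) * (L + 1)) (fst (grid K L i))" "fits ((K + 1) * (L + 1)) (snd (grid K L i))"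
proof -
  have pow: "fits ((K + 1) * (L + 1)) (x ^ e)" if "x \<le> K + 1" "e \<le> L + 1" for x e
  proof -
    have "x ^ e \<le> (K + 1) ^ (L + 1)"
      using that by (meson le_add2 order_trans power_increasing power_mono zero_le)
    also have "\<dots> < (2 ^ (K + 1)) ^ (L + 1)" by (intro power_strict_mono less_exp) auto
    finally show ?thesis unfolding fits_def power_mult .
  qed
  show "fits ((K + 1) * (L + 1)) (fst (grid K L i))" "fits ((K + 1) * (L + 1)) (snd (grid K L i))"
    unfolding grid_def using assms
    by (cases "i < L"; simp only: if_True if_False fst_conv snd_conv; intro pow; linarith)+
qed

lemma grid_gt_iff: "1 \<le> K \<Longrightarrow> snd (grid K L i) < fst (grid K L i) \<longleftrightarrow> i < L"
  by (auto simp: grid_def power_strict_mono power_mono not_less)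

text \<open>The update rule of the program, which stores only the current fraction. Above 1 the
  exponent \<open>L - i\<close> is positive, so both divisions are exact; from 1 on the fraction is
  multiplied. By \<open>grid_gt_iff\<close> comparing numerator and denominator tells the two cases
  apart.\<close>

lemma grid_Suc:
  assumes "1 \<le> K"
  shows "grid K L (Suc i) = (if i < L
    then (fst (grid K L i) div (K + 1), snd (grid K L i) div K)
    else (fst (grid K L i) * K, snd (grid K L i) * (K + 1)))"
proof (cases "i < L")
  case True
  then obtain d where d: "L = Suc i + d" by (metis Suc_leI le_Suc_ex)
  have "grid K L i = ((K + 1) * (K + 1) ^ d, K * K ^ d)" "grid K L (Suc i) = ((K + 1) ^ d, K ^ d)"
    using d by (auto simp: grid_def)
  moreover have "(K + 1) * (K + 1) ^ d div (K + 1) = (K + 1) ^ d" "K * K ^ d div K = K ^ d"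
    using assms by (simp_all only: nonzero_mult_div_cancel_left)
  ultimately show ?thesis using True by (simp only: fst_conv snd_conv if_True)
next
  case False
  then show ?thesis by (simp add: grid_def Suc_diff_le mult.commute)
qed

lemma ratio_grid_Suc:
  assumes "1 \<le> K"
  shows "ratio (grid K L (Suc i)) * (real K + 1) = ratio (grid K L i) * real K"
proof (cases "i < L")
  case True
  then obtain d where d: "L = Suc i + d" by (metis Suc_leI le_Suc_ex)
  then show ?thesis using assms by (auto simp: grid_def ratio_def field_simps)
next
  case False
  then obtain e where e: "i = L + e" by (metis le_Suc_ex not_less)
  have "ratio (grid K L (Suc i)) = real K * real K ^ e / ((real K + 1) * (real K + 1) ^ e)"
    "ratio (grid K L i) = real K ^ e / (real K + 1) ^ e"
    using e by (simp_all add: grid_def ratio_def add.commute distrib_right)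
  moreover have "real K * x / ((real K + 1) * y) * (real K + 1) = x / y * real K" for x y :: real
    by (simp add: divide_simps)
  ultimately show ?thesis by simp
qed

text \<open>Bernoulli's inequality for (1 + 1 / K) ^ K. So \<open>K\<close> grid steps change the
  level at least by a factor 2, and \<open>K * b\<close> steps by 2 ^ b.\<close>

lemma two_le_compound:
  assumes "1 \<le> K"
  shows "2 * real K ^ K \<le> (real K + 1) ^ K"
proof -
  have "1 + real K * (1 / real K) \<le> (1 + 1 / real K) ^ K"
    by (rule Bernoulli_inequality) (simp add: order_trans[of _ 0])
  then have "2 \<le> ((real K + 1) / real K) ^ K"
    using assms by (simp add: field_simps)
  then show ?thesis using assms by (simp add: power_divide field_simps)
qed

text \<open>A discrete intermediate value argument: the grid starts at or above x, and if a level is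
  at least (K + 1) / K times x, then the next one is still at least x. Without a level as wanted,
  the last one, which is at most 1 / 2 ^ b, would be at least x.\<close>

lemma exists_grid_level:
  assumes K: "1 \<le> K" and x: "1 < x * 2 ^ b" "x \<le> 2 ^ b"
  shows "\<exists>i \<le> 2 * (K * b). x \<le> ratio (grid K (K * b) i) \<and>
    ratio (grid K (K * b) i) * real K < (real K + 1) * x"
proof (rule ccontr)
  assume contr: "\<not> ?thesis"
  let ?r = "\<lambda>i. ratio (grid K (K * b) i)"
  have pow: "2 ^ b * real K ^ (K * b) \<le> (real K + 1) ^ (K * b)"
    using power_mono[OF two_le_compound[OF K], of b] by (simp add: power_mult power_mult_distrib)
  have "x \<le> ?r i" if "i \<le> 2 * (K * b)" for i
    using that
  proof (induction i)
    case 0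
    have "2 ^ b \<le> ?r 0" using pow K by (simp add: grid_0 ratio_def field_simps)
    then show ?case using x by simp
  next
    case (Suc i)
    then have "\<not> ?r i * real K < (real K + 1) * x" using contr by auto
    then have "(real K + 1) * x \<le> (real K + 1) * ?r (Suc i)"
      using ratio_grid_Suc[OF K, of "K * b" i] by (simp add: mult.commute)
    then show ?case by simp
  qed
  from this[of "2 * (K * b)"] have "x \<le> real K ^ (K * b) / (real K + 1) ^ (K * b)"
    by (auto simp: grid_def ratio_def add.commute split: if_splits)
  then have "x * (real K + 1) ^ (K * b) \<le> real K ^ (K * b)" by (simp add: field_simps)
  moreover have "0 < x" using x(1) by (smt (verit) zero_less_power mult_nonpos_nonneg)
  ultimately have "x * (2 ^ b * real K ^ (K * b)) \<le> real K ^ (K * b)"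
    using mult_left_mono[OF pow, of x] by linarith
  then have "(x * 2 ^ b) * real K ^ (K * b) \<le> 1 * real K ^ (K * b)" by (simp add: mult.assoc)
  then have "x * 2 ^ b \<le> 1" using K by (subst (asm) mult_le_cancel_right) auto
  then show False using x by simp
qed

definition level :: "nat \<Rightarrow> (nat \<Rightarrow> nat set \<Rightarrow> real) \<Rightarrow> nat \<Rightarrow> nat \<Rightarrow> nat \<Rightarrow> nat \<times> nat" where
  "level n u K b k = (if k < n then fraction_of (u k {}) else grid K (K * b) (k - n))"

text \<open>Choose the smallest level that is at least x. It does not exceed the grid level of
  \<open>exists_grid_level\<close>, and no value \<open>u j {}\<close> lies between x and it, as
  such a value would itself be a smaller level.\<close>

lemma exists_good_level:
  assumes K: "1 \<le> K" and x: "1 < x * 2 ^ b" "x \<le> 2 ^ b"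
    and u: "\<And>j. j < n \<Longrightarrow> u j {} \<in> \<rat> \<and> 0 \<le> u j {}"
  shows "\<exists>k < n + 2 * (K * b) + 1. x \<le> ratio (level n u K b k) \<and>
    ratio (level n u K b k) * real K < (real K + 1) * x \<and>
    (\<forall>j<n. u j {} < ratio (level n u K b k) \<longrightarrow> u j {} < x)"
proof -
  let ?r = "\<lambda>k. ratio (level n u K b k)"
  let ?A = "{k. k < n + 2 * (K * b) + 1 \<and> x \<le> ?r k}"
  obtain i where i: "i \<le> 2 * (K * b)" "x \<le> ratio (grid K (K * b) i)"
    "ratio (grid K (K * b) i) * real K < (real K + 1) * x"
    using exists_grid_level[OF K x] by blast
  have iA: "n + i \<in> ?A" using i by (simp add: level_def)
  have fin: "finite ?A" by simp
  define k where "k = arg_min_on ?r ?A"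
  have k: "k \<in> ?A" "\<forall>k'\<in>?A. ?r k \<le> ?r k'"
    using arg_min_if_finite(1)[OF fin, of ?r] arg_min_least[OF fin, of _ ?r] iA unfolding k_def by blast+
  have "?r k * real K \<le> ratio (grid K (K * b) i) * real K"
    using bspec[OF k(2) iA] by (intro mult_right_mono) (simp_all add: level_def)
  moreover have gap: "u j {} < x" if j: "j < n" "u j {} < ?r k" for j
  proof (rule ccontr)
    assume "\<not> u j {} < x"
    moreover have "?r j = u j {}"
      using u[OF j(1)] j(1) by (auto simp: level_def ratio_def elim!: fraction_of_cases)
    ultimately have "j \<in> ?A" using j(1) by simp
    then have "?r k \<le> ?r j" using k(2) by blast
    then show False using j(2) \<open>?r j = u j {}\<close> by simp
  qed
  ultimately show ?thesis using k(1) i(3) by (intro exI[of _ k]) auto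
qed

section \<open>Simulating the assignment algorithm\<close>

text \<open>
  The cells below address \<open>40\<close> hold the variables of the program. The other cells are arranged in \<open>R\<close> infinite
  rows, so that every simulated run has a fresh memory of its own. No row uses the addresses below \<open>R\<close>, which
  are reserved for the output.
\<close>

definition adr :: "nat \<Rightarrow> nat \<Rightarrow> nat \<Rightarrow> nat" where
  "adr R r a = 40 + R * (a + 1) + r"

definition row :: "memory \<Rightarrow> nat \<Rightarrow> nat \<Rightarrow> memory" where
  "row s R r = (\<lambda>a. s (adr R r a))"

lemma adr_eq_iff [simp]:
  assumes "r < R" "r' < R"
  shows "adr R r a = adr R r' a' \<longleftrightarrow> r = r' \<and> a = a'"
proof
  assume "adr R r a = adr R r' a'"
  then have eq: "R * (a + 1) + r = R * (a' + 1) + r'" by (simp add: adr_def)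
  have "(R * (a + 1) + r) mod R = r" "(R * (a' + 1) + r') mod R = r'"
    using assms by (simp_all only: mod_mult_self4 mod_less)
  then have "r = r'" unfolding eq by (rule trans[OF sym])
  then show "r = r' \<and> a = a'" using eq assms by simp
qed simp

lemma adr_neq_small [simp]: "x < 40 \<Longrightarrow> adr R r a \<noteq> x" "x < 40 \<Longrightarrow> x \<noteq> adr R r a"
  by (simp_all add: adr_def)

lemma row_upd_small [simp]: "x < 40 \<Longrightarrow> row (s(x := v)) R r = row s R r"
  by (simp add: row_def)

lemma row_upd_adr [simp]:
  "r < R \<Longrightarrow> r' < R \<Longrightarrow>
    row (s(adr R r a := v)) R r' = (if r' = r then (row s R r)(a := v) else row s R r')"
  by (auto simp: row_def)

text \<open>
  \<open>vP / vQ\<close> is the current grid level, \<open>vVP / vVQ\<close> the truncation level, \<open>vMP / vMQ\<close> the value of the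
  current allocation, and \<open>vBP / vBQ\<close> a lower bound on the value of the best allocation so far, which is stored
  in row \<open>vBest\<close>.
\<close>

abbreviation (input) "vR \<equiv> 3 :: nat"
abbreviation (input) "vBest \<equiv> 4 :: nat"
abbreviation (input) "vN \<equiv> 5 :: nat"
abbreviation (input) "vM \<equiv> 6 :: nat"
abbreviation (input) "vB \<equiv> 7 :: nat"
abbreviation (input) "vL \<equiv> 8 :: nat"
abbreviation (input) "vLevels \<equiv> 9 :: nat"
abbreviation (input) "vP \<equiv> 10 :: nat"
abbreviation (input) "vQ \<equiv> 11 :: nat"
abbreviation (input) "vK \<equiv> 12 :: nat"
abbreviation (input) "vVP \<equiv> 13 :: nat"
abbreviation (input) "vVQ \<equiv> 14 :: nat"
abbreviation (input) "vRow \<equiv> 15 :: nat"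
abbreviation (input) "vRank \<equiv> 16 :: nat"
abbreviation (input) "vJ \<equiv> 17 :: nat"
abbreviation (input) "vX \<equiv> 18 :: nat"
abbreviation (input) "vY \<equiv> 19 :: nat"
abbreviation (input) "vD \<equiv> 20 :: nat"
abbreviation (input) "vA \<equiv> 21 :: nat"
abbreviation (input) "vS \<equiv> 22 :: nat"
abbreviation (input) "vBP \<equiv> 23 :: nat"
abbreviation (input) "vBQ \<equiv> 24 :: nat"
abbreviation (input) "vMP \<equiv> 25 :: nat"
abbreviation (input) "vMQ \<equiv> 26 :: nat"
abbreviation (input) "vPos \<equiv> 27 :: nat"
abbreviation (input) "vPow \<equiv> 28 :: nat"
abbreviation (input) "vOk \<equiv> 29 :: nat"
abbreviation (input) "vI \<equiv> 30 :: nat"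
abbreviation (input) "vT \<equiv> 31 :: nat"
abbreviation (input) "vCnt \<equiv> 32 :: nat"

definition Var :: "nat \<Rightarrow> aexp" where
  "Var x = Mem (Const x)"

definition Adr :: "aexp \<Rightarrow> aexp \<Rightarrow> aexp" where
  "Adr r a = Add (Add (Const 40) (Mul (Var vR) (Add a (Const 1)))) r"

definition Cell :: "aexp \<Rightarrow> aexp \<Rightarrow> aexp" where
  "Cell r a = Mem (Adr r a)"

definition Set :: "nat \<Rightarrow> aexp \<Rightarrow> com" where
  "Set x a = Assign (Const x) a"

lemma aval_Var [simp]: "aval (Var x) s = s x"
  by (simp add: Var_def)

lemma aval_Adr [simp]: "aval (Adr r a) s = adr (s vR) (aval r s) (aval a s)"
  by (simp add: Adr_def adr_def)

lemma aval_Cell [simp]: "aval (Cell r a) s = row s (s vR) (aval r s) (aval a s)"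
  by (simp add: Cell_def row_def)

lemma reads_fit_Var [simp]: "reads_fit B (Var x) s \<longleftrightarrow> fits B x \<and> fits B (s x)"
  by (simp add: Var_def)

lemma reads_fit_Adr [simp]: "40 \<le> B \<Longrightarrow>
    reads_fit B (Adr r a) s \<longleftrightarrow> fits B (s vR) \<and> reads_fit B a s \<and> reads_fit B r s"
  by (auto simp: Adr_def)

lemma reads_fit_Cell [simp]: "40 \<le> B \<Longrightarrow>
    reads_fit B (Cell r a) s \<longleftrightarrow> fits B (s vR) \<and> reads_fit B a s \<and> reads_fit B r s \<and>
      fits B (row s (s vR) (aval r s) (aval a s))"
  by (auto simp: Cell_def row_def)

lemma wp_Set [simp]: "wp \<Omega> B (Set x a) Q s \<longleftrightarrow> fits B x \<and> reads_fit B a s \<and> Q (s(x := aval a s))"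
  by (simp add: Set_def)

section \<open>Relocating a program into one row of the memory\<close>

fun translate_aexp :: "aexp \<Rightarrow> aexp" where
  "translate_aexp (Const k) = Const k"
| "translate_aexp (Mem a) = Cell (Var vRow) (translate_aexp a)"
| "translate_aexp (Add a b) = Add (translate_aexp a) (translate_aexp b)"
| "translate_aexp (Sub a b) = Sub (translate_aexp a) (translate_aexp b)"
| "translate_aexp (Mul a b) = Mul (translate_aexp a) (translate_aexp b)"
| "translate_aexp (Div a b) = Div (translate_aexp a) (translate_aexp b)"

text \<open>
  Row \<open>0\<close> lists the agents that are jobs of the simulated instance, and answers exceeding the
  truncation level are replaced by it.
\<close>

fun translate :: "com \<Rightarrow> com" where
  "translate Skip = Skip"
| "translate (Assign d a) = Assign (Adr (Var vRow) (translate_aexp d)) (translate_aexp a)"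
| "translate (Query d a b) =
     Seq (Set vD (translate_aexp d))
    (Seq (Set vA (translate_aexp a))
    (Seq (Set vS (translate_aexp b))
    (Seq (If (Sub (Var vRank) (Var vA))
           (Seq (Query (Const vX) (Cell (Const 0) (Var vA)) (Var vS))
             (If (Sub (Mul (Var vX) (Var vVQ)) (Mul (Var vVP) (Var vY)))
               (Seq (Set vX (Var vVP)) (Set vY (Var vVQ)))
               Skip))
           (Seq (Set vX (Const 0)) (Set vY (Const 1))))
    (Seq (Assign (Adr (Var vRow) (Var vD)) (Var vX))
         (Assign (Adr (Var vRow) (Add (Var vD) (Const 1))) (Var vY))))))"
| "translate (Seq c d) = Seq (translate c) (translate d)"
| "translate (If a c d) = If (translate_aexp a) (translate c) (translate d)"
| "translate (While a c) = While (translate_aexp a) (translate c)"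

lemma aval_translate:
  "s vR = R \<Longrightarrow> s vRow = r \<Longrightarrow> aval (translate_aexp e) s = aval e (row s R r)"
  by (induction e) (auto simp: row_def)

lemma bit_length_aval_le_acost: "bit_length (aval e s) \<le> acost e s"
  by (cases e) auto

text \<open>Every read is charged its length, so the cost A of evaluating \<open>e\<close> in the
  simulated memory bounds the lengths of all numbers read there. No bound on the contents of the row
  has to be known in advance; B only covers the bookkeeping.\<close>

lemma reads_fit_translate:
  assumes "40 \<le> B" "fits B R" "fits B r" "s vR = R" "s vRow = r" "acost e (row s R r) \<le> A"
  shows "reads_fit (B + A) (translate_aexp e) s"
  using assms(6)
proof (induction e)
  case (Const k)
  then show ?case by (simp add: bit_length_le_iff[symmetric])
next
  case (Mem a)
  have "fits A (row s R r (aval a (row s R r)))"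
    using Mem.prems by (simp add: bit_length_le_iff[symmetric])
  then have "fits (B + A) (row s R r (aval a (row s R r)))" by (rule fits_mono) simp
  moreover have "fits (B + A) R" "fits (B + A) r" using assms by (auto intro: fits_mono)
  ultimately show ?case using Mem assms by (simp add: aval_translate)
qed auto

definition same_except :: "nat set \<Rightarrow> memory \<Rightarrow> memory \<Rightarrow> bool" where
  "same_except X s s' \<longleftrightarrow> (\<forall>x. x \<notin> X \<longrightarrow> s' x = s x)"

lemma same_except_trans: "same_except X s s' \<Longrightarrow> same_except X s' s'' \<Longrightarrow> same_except X s s''"
  by (simp add: same_except_def)

lemma same_except_refl [simp]: "same_except X s s"
  by (simp add: same_except_def)

definition sim_cells :: "nat \<Rightarrow> nat \<Rightarrow> nat set" where
  "sim_cells R r = {vX, vY, vD, vA, vS} \<union> range (adr R r)"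

definition sim_env ::
    "nat \<Rightarrow> nat \<Rightarrow> nat \<times> nat \<Rightarrow> nat list \<Rightarrow> memory \<Rightarrow> bool" where
  "sim_env R r V js s \<longleftrightarrow> s vR = R \<and> s vRow = r \<and> s vVP = fst V \<and> s vVQ = snd V \<and>
     s vRank = length js \<and> (\<forall>i < length js. row s R 0 i = js ! i)"

lemma sim_env_same_except:
  assumes "sim_env R r V js s" "same_except (sim_cells R r) s s'" "0 < r" "r < R"
  shows "sim_env R r V js s'"
proof -
  have "adr R 0 i \<notin> sim_cells R r" for i
    using assms(3,4) by (auto simp: sim_cells_def)
  then have "row s' R 0 i = row s R 0 i" for i
    using assms(2) by (simp add: row_def same_except_def)
  moreover have "s' x = s x" if "x \<in> {vR, vRow, vVP, vVQ, vRank}" for x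
    using assms(2) that by (auto simp: same_except_def sim_cells_def image_iff)
  ultimately show ?thesis using assms(1) by (simp add: sim_env_def)
qed

text \<open>The minimum of two fractions, decided by cross-multiplication in the natural
  numbers.\<close>

definition clip :: "nat \<times> nat \<Rightarrow> nat \<times> nat \<Rightarrow> nat \<times> nat" where
  "clip V x = (if fst V * snd x < fst x * snd V then V else x)"

text \<open>\<Omega> is the oracle of the machine, \<Omega>' the one that the simulated program
  believes to query. Row 0 holds \<open>js\<close>, so the simulated memory must be another
  row.\<close>

locale simulation =
  fixes \<Omega> \<Omega>' :: oracle_fun and B R r :: nat and V :: "nat \<times> nat" and js :: "nat list"
  assumes answers: "\<And>j x. \<Omega>' j x = (if j < length js then clip V (\<Omega> (js ! j) x) else (0, 1))"
    and B: "40 \<le> B" "fits B R" "fits B r" "fits B (fst V)" "fits B (snd V)" "fits B (length js)"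
    and js_fits: "\<And>i. i < length js \<Longrightarrow> fits B (js ! i)"
    and answers_fit: "\<And>j x. fits B (fst (\<Omega> j x)) \<and> fits B (snd (\<Omega> j x))"
    and r: "0 < r" "r < R"
begin

lemma acost_translate_le:
  assumes "sim_env R r V js s"
  shows "acost (translate_aexp e) s \<le> aweight (translate_aexp e) * (B + acost e (row s R r) + 1)"
proof -
  have "reads_fit (B + acost e (row s R r)) (translate_aexp e) s"
    using assms B by (intro reads_fit_translate) (auto simp: sim_env_def)
  then show ?thesis using acost_le B by simp
qed

lemma cond_cost:
  assumes "sim_env R r V js s" "1 + aweight (translate_aexp e) \<le> Z"
  shows "1 + acost (translate_aexp e) s \<le> 2 * Z * (B + 1) * (1 + acost e (row s R r))"
proof -
  let ?A = "acost e (row s R r)" and ?w = "aweight (translate_aexp e)"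
  have "1 + acost (translate_aexp e) s \<le> (1 + ?w) * (B + ?A + 1)"
    using acost_translate_le[OF assms(1), of e] by simp
  also have "\<dots> \<le> Z * (2 * (B + 1) * (1 + ?A))"
    using assms(2) by (intro mult_mono) auto
  also have "\<dots> = 2 * Z * (B + 1) * (1 + ?A)" by (simp only: ac_simps)
  finally show ?thesis .
qed

lemma runs_translate_Assign:
  assumes env: "sim_env R r V js s" and t: "t = 1 + acost d (row s R r) + acost a (row s R r)"
  shows "runs \<Omega> (translate (Assign d a)) s (cweight (translate (Assign d a)) * (B + t + 1))
    (\<lambda>s'. row s' R r = (row s R r)(aval d (row s R r) := aval a (row s R r)) \<and>
      same_except (sim_cells R r) s s')"
proof (rule runs_wp)
  have "reads_fit (B + t) (translate_aexp d) s" "reads_fit (B + t) (translate_aexp a) s"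
    by (rule reads_fit_translate[OF B(1-3)]; use env t in \<open>simp add: sim_env_def\<close>)+
  moreover have "fits (B + t) R" "fits (B + t) r" using B by (auto intro: fits_mono)
  ultimately show "wp \<Omega> (B + t) (translate (Assign d a)) (\<lambda>s'. row s' R r =
      (row s R r)(aval d (row s R r) := aval a (row s R r)) \<and> same_except (sim_cells R r) s s') s"
    using env B r by (simp add: sim_env_def aval_translate same_except_def sim_cells_def)
qed (use B in simp)

lemma runs_translate_Query:
  assumes env: "sim_env R r V js s"
    and xy: "\<Omega>' (aval a (row s R r)) (aval b (row s R r)) = (x, y)"
    and t: "t = 1 + acost d (row s R r) + acost a (row s R r) + acost b (row s R r) + bit_length x + bit_length y"
  shows "runs \<Omega> (translate (Query d a b)) s (cweight (translate (Query d a b)) * (B + t + 1))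
    (\<lambda>s'. row s' R r = (row s R r)(aval d (row s R r) := x, aval d (row s R r) + 1 := y) \<and>
      same_except (sim_cells R r) s s')"
proof (rule runs_wp)
  let ?s = "row s R r"
  have rf: "reads_fit (B + t) (translate_aexp e) s'"
    if "e \<in> {d, a, b}" "s' vR = R" "s' vRow = r" "row s' R r = ?s" for e s'
    using that B t by (intro reads_fit_translate) auto
  have av: "aval (translate_aexp e) s' = aval e ?s"
    if "s' vR = R" "s' vRow = r" "row s' R r = ?s" for e s'
    using that aval_translate by metis
  have f: "fits (B + t) z" if "fits B z" for z using that by (rule fits_mono) simp
  have fv: "fits (B + t) (aval e ?s)" if "e \<in> {d, a, b}" for e
    using bit_length_aval_le_acost[of e ?s] that t by (intro fits_mono[OF fits_bit_length]) auto
  have B': "40 \<le> B + t" using B by simp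
  have env': "s vR = R" "s vRow = r" "s vVP = fst V" "s vVQ = snd V" "s vRank = length js"
    "\<And>i. i < length js \<Longrightarrow> row s R 0 i = js ! i"
    using env by (auto simp: sim_env_def)
  \<comment> \<open>The two possible final memories: \<open>vX\<close> and \<open>vY\<close> are
    written a second time only if the answer of \<Omega> is replaced by the truncation
    level.\<close>
  have se: "same_except (sim_cells R r) s
      (s(vD := v1, vA := v2, vS := v3, vX := v4, vY := v5, adr R r v6 := v7, adr R r v8 := v9))"
    "same_except (sim_cells R r) s
      (s(vD := v1, vA := v2, vS := v3, vX := v4, vY := v5, vX := v10, vY := v11, adr R r v6 := v7, adr R r v8 := v9))"
    for v1 v2 v3 v4 v5 v6 v7 v8 v9 v10 v11
    by (auto simp: same_except_def sim_cells_def)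
  show "wp \<Omega> (B + t) (translate (Query d a b)) (\<lambda>s'.
      row s' R r = ?s(aval d ?s := x, aval d ?s + 1 := y) \<and> same_except (sim_cells R r) s s') s"
  proof (cases "aval a ?s < length js")
    case True
    then have xy': "clip V (\<Omega> (js ! aval a ?s) (aval b ?s)) = (x, y)"
      using xy answers by simp
    show ?thesis
      using True B' r env' rf av f fv B js_fits answers_fit xy' se
      by (auto simp: clip_def split: if_splits)
  next
    case False
    then have "x = 0" "y = 1" using xy answers by auto
    then show ?thesis
      using False B' r env' rf av f fv B se by auto
  qed
qed (use B in simp)

text \<open>The slowdown is a factor linear in B. Z bounds the weight of the whole program, hence of
  every subprogram met in the induction, so the factor stays the same when a loop is unfolded and
  the times simply add up. The 2 comes from B + t + 1 \<le> 2 * (B + 1) * t for t \<ge> 1.\<close>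

lemma exec_translate:
  assumes "exec \<Omega>' c v t v'" "cweight (translate c) \<le> Z" "sim_env R r V js s" "row s R r = v"
  shows "\<exists>t' s'. exec \<Omega> (translate c) s t' s' \<and> t' \<le> 2 * Z * (B + 1) * t \<and>
    row s' R r = v' \<and> same_except (sim_cells R r) s s'"
  using assms
proof (induction arbitrary: s rule: exec.induct)
  case (Skip v)
  then have "1 \<le> 2 * Z * (B + 1) * 1" by simp
  then show ?case using Skip exec.Skip[of \<Omega> s] unfolding translate.simps by (metis same_except_refl)
next
  case (Assign d a v)
  let ?t = "1 + acost d v + acost a v"
  have "cweight (translate (Assign d a)) * (B + ?t + 1) \<le> Z * (2 * (B + 1) * ?t)"
    using Assign.prems by (intro mult_mono) auto
  also have "\<dots> = 2 * Z * (B + 1) * ?t" by (simp only: ac_simps)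
  finally have le: "cweight (translate (Assign d a)) * (B + ?t + 1) \<le> 2 * Z * (B + 1) * ?t" .
  have "?t = 1 + acost d (row s R r) + acost a (row s R r)" using Assign.prems(3) by simp
  from runs_translate_Assign[OF Assign.prems(2) this] obtain t' s'
    where *: "exec \<Omega> (translate (Assign d a)) s t' s'" "t' \<le> cweight (translate (Assign d a)) * (B + ?t + 1)"
      "row s' R r = v(aval d v := aval a v)" "same_except (sim_cells R r) s s'"
    unfolding runs_def Assign.prems(3) by blast
  have "t' \<le> 2 * Z * (B + 1) * ?t" using *(2) le by (rule order_trans)
  with *(1,3,4) show ?case by blast
next
  case (Query a v b x y d)
  let ?t = "1 + acost d v + acost a v + acost b v + bit_length x + bit_length y"
  have "cweight (translate (Query d a b)) * (B + ?t + 1) \<le> Z * (2 * (B + 1) * ?t)"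
    using Query.prems by (intro mult_mono) auto
  also have "\<dots> = 2 * Z * (B + 1) * ?t" by (simp only: ac_simps)
  finally have le: "cweight (translate (Query d a b)) * (B + ?t + 1) \<le> 2 * Z * (B + 1) * ?t" .
  have t: "?t = 1 + acost d (row s R r) + acost a (row s R r) + acost b (row s R r) + bit_length x + bit_length y"
    using Query.prems(3) by simp
  have "\<Omega>' (aval a (row s R r)) (aval b (row s R r)) = (x, y)"
    using Query.prems(3) Query.hyps by simp
  from runs_translate_Query[OF Query.prems(2) this t] obtain t' s'
    where *: "exec \<Omega> (translate (Query d a b)) s t' s'" "t' \<le> cweight (translate (Query d a b)) * (B + ?t + 1)"
      "row s' R r = v(aval d v := x, aval d v + 1 := y)" "same_except (sim_cells R r) s s'"
    unfolding runs_def Query.prems(3) by blast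
  have "t' \<le> 2 * Z * (B + 1) * ?t" using *(2) le by (rule order_trans)
  with *(1,3,4) show ?case by blast
next
  case (Seq c v t v' d t' v'')
  obtain u s' where 1: "exec \<Omega> (translate c) s u s'" "u \<le> 2 * Z * (B + 1) * t"
    "row s' R r = v'" "same_except (sim_cells R r) s s'"
    using Seq.IH(1)[OF _ Seq.prems(2,3)] Seq.prems(1) by auto
  obtain u' s'' where 2: "exec \<Omega> (translate d) s' u' s''" "u' \<le> 2 * Z * (B + 1) * t'"
    "row s'' R r = v''" "same_except (sim_cells R r) s' s''"
    using Seq.IH(2)[OF _ sim_env_same_except[OF Seq.prems(2) 1(4) r] 1(3)] Seq.prems(1) by auto
  have "1 \<le> 2 * Z * (B + 1)" using Seq.prems(1) by simp
  then have "1 + u + u' \<le> 2 * Z * (B + 1) * (1 + t + t')"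
    using 1(2) 2(2) by (simp only: distrib_left mult_1_right)
  then show ?case using exec.Seq[OF 1(1) 2(1)] 2(3) same_except_trans[OF 1(4) 2(4)]
    unfolding translate.simps by blast
next
  case (IfTrue a v c t v' d)
  obtain u s' where 1: "exec \<Omega> (translate c) s u s'" "u \<le> 2 * Z * (B + 1) * t"
    "row s' R r = v'" "same_except (sim_cells R r) s s'"
    using IfTrue.IH[OF _ IfTrue.prems(2,3)] IfTrue.prems(1) by auto
  have a: "aval (translate_aexp a) s \<noteq> 0"
    using IfTrue.hyps(1) IfTrue.prems by (simp add: aval_translate sim_env_def)
  have "1 + acost (translate_aexp a) s \<le> 2 * Z * (B + 1) * (1 + acost a v)"
    using cond_cost[OF IfTrue.prems(2), of a Z] IfTrue.prems by simp
  then have "1 + acost (translate_aexp a) s + u \<le> 2 * Z * (B + 1) * (1 + acost a v + t)"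
    using 1(2) unfolding distrib_left[of _ "1 + acost a v" t] by linarith
  then show ?case using exec.IfTrue[OF a 1(1)] 1(3,4) unfolding translate.simps by blast
next
  case (IfFalse a v c t v' d)
  obtain u s' where 1: "exec \<Omega> (translate c) s u s'" "u \<le> 2 * Z * (B + 1) * t"
    "row s' R r = v'" "same_except (sim_cells R r) s s'"
    using IfFalse.IH[OF _ IfFalse.prems(2,3)] IfFalse.prems(1) by auto
  have a: "aval (translate_aexp a) s = 0"
    using IfFalse.hyps(1) IfFalse.prems by (simp add: aval_translate sim_env_def)
  have "1 + acost (translate_aexp a) s \<le> 2 * Z * (B + 1) * (1 + acost a v)"
    using cond_cost[OF IfFalse.prems(2), of a Z] IfFalse.prems by simp
  then have "1 + acost (translate_aexp a) s + u \<le> 2 * Z * (B + 1) * (1 + acost a v + t)"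
    using 1(2) unfolding distrib_left[of _ "1 + acost a v" t] by linarith
  then show ?case using exec.IfFalse[OF a 1(1)] 1(3,4) unfolding translate.simps by blast
next
  case (WhileTrue a v c t v' t' v'')
  obtain u s' where 1: "exec \<Omega> (translate c) s u s'" "u \<le> 2 * Z * (B + 1) * t"
    "row s' R r = v'" "same_except (sim_cells R r) s s'"
    using WhileTrue.IH(1)[OF _ WhileTrue.prems(2,3)] WhileTrue.prems(1) by auto
  obtain u' s'' where 2: "exec \<Omega> (translate (While a c)) s' u' s''" "u' \<le> 2 * Z * (B + 1) * t'"
    "row s'' R r = v''" "same_except (sim_cells R r) s' s''"
    using WhileTrue.IH(2)[OF WhileTrue.prems(1) sim_env_same_except[OF WhileTrue.prems(2) 1(4) r] 1(3)]
    by auto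
  have a: "aval (translate_aexp a) s \<noteq> 0"
    using WhileTrue.hyps(1) WhileTrue.prems by (simp add: aval_translate sim_env_def)
  have "1 + acost (translate_aexp a) s \<le> 2 * Z * (B + 1) * (1 + acost a v)"
    using cond_cost[OF WhileTrue.prems(2), of a Z] WhileTrue.prems by simp
  then have "1 + acost (translate_aexp a) s + u + u' \<le> 2 * Z * (B + 1) * (1 + acost a v + t + t')"
    using 1(2) 2(2)
    unfolding distrib_left[of _ "1 + acost a v + t" t'] distrib_left[of _ "1 + acost a v" t] by linarith
  then show ?case
    using exec.WhileTrue[OF a 1(1) 2(1)[unfolded translate.simps]] 2(3) same_except_trans[OF 1(4) 2(4)]
    unfolding translate.simps by blast
next
  case (WhileFalse a v c)
  have a: "aval (translate_aexp a) s = 0"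
    using WhileFalse.hyps(1) WhileFalse.prems by (simp add: aval_translate sim_env_def)
  have "1 + acost (translate_aexp a) s \<le> 2 * Z * (B + 1) * (1 + acost a v)"
    using cond_cost[OF WhileFalse.prems(2), of a Z] WhileFalse.prems by simp
  then show ?case using exec.WhileFalse[OF a] WhileFalse.prems(3) same_except_refl
    unfolding translate.simps by blast
qed

end

text \<open>As V is in lowest terms, it is literally the answer for a value cut off at
  \<open>ratio V\<close>. Outside the domain both sides are the default (0, 1), which clipping
  leaves alone since 0 never exceeds a level.\<close>

lemma value_oracle_speeds:
  assumes u: "\<And>j S. j < n \<Longrightarrow> S \<subseteq> {..<m} \<Longrightarrow> u j S \<in> \<rat> \<and> 0 \<le> u j S"
    and V: "0 < snd V" "coprime (fst V) (snd V)"
  shows "value_oracle (rank u (ratio V) n) m (speeds n u (ratio V)) j x =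
    (if j < length (active_list u (ratio V) n)
     then clip V (value_oracle n m u (active_list u (ratio V) n ! j) x) else (0, 1))"
proof (cases "j < length (active_list u (ratio V) n)")
  case True
  let ?i = "active_list u (ratio V) n ! j"
  have i: "?i < n" using active_list_nth(1)[of j u "ratio V" n] True by (simp add: rank_def)
  have fV: "fraction_of (ratio V) = V"
    using fraction_of_eqI[of "ratio V" "fst V" "snd V"] V by (simp add: ratio_def)
  show ?thesis
  proof (cases "set_decode x \<subseteq> {..<m}")
    case sub: True
    obtain p q where pq: "fraction_of (u ?i (set_decode x)) = (p, q)"
      "u ?i (set_decode x) = real p / real q" "0 < q"
      using u[OF i sub] by (auto elim: fraction_of_cases)
    have "fst V * q < p * snd V \<longleftrightarrow> real (fst V) * real q < real p * real (snd V)"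
      by (metis of_nat_less_iff of_nat_mult)
    also have "\<dots> \<longleftrightarrow> ratio V < real p / real q"
      using pq(3) V(1) by (simp add: ratio_def field_simps)
    finally have "fst V * q < p * snd V \<longleftrightarrow> ratio V < u ?i (set_decode x)"
      by (simp only: pq(2))
    then show ?thesis using True sub i pq fV
      by (auto simp: value_oracle_def rank_def speeds_def truncation_def clip_def min_def)
  next
    case False
    then show ?thesis using True by (auto simp: value_oracle_def clip_def)
  qed
next
  case False
  then show ?thesis by (simp add: value_oracle_def rank_def)
qed

section \<open>The program and its correctness\<close>

notation Seq (infixr \<open>;;\<close> 60)

text \<open>\<open>Sub\<close> is cut off at 0, so the value is nonzero iff the fraction in the
  cells a, b is smaller than the one in c, d after cross-multiplication.\<close>

definition Less :: "nat \<Rightarrow> nat \<Rightarrow> nat \<Rightarrow> nat \<Rightarrow> aexp" where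
  "Less a b c d = Sub (Mul (Var c) (Var b)) (Mul (Var a) (Var d))"

lemma aval_Less [simp]: "aval (Less a b c d) s = s c * s b - s a * s d"
  by (simp add: Less_def)

lemma reads_fit_Less [simp]: "reads_fit B (Less a b c d) s \<longleftrightarrow>
    reads_fit B (Var a) s \<and> reads_fit B (Var b) s \<and> reads_fit B (Var c) s \<and> reads_fit B (Var d) s"
  by (auto simp: Less_def)

definition Inc :: "nat \<Rightarrow> com" where
  "Inc x = Set x (Add (Var x) (Const 1))"

lemma wp_Inc [simp]: "1 \<le> B \<Longrightarrow>
    wp \<Omega> B (Inc x) Q s \<longleftrightarrow> fits B x \<and> fits B (s x) \<and> Q (s(x := Suc (s x)))"
  by (auto simp: Inc_def)

text \<open>Level k uses row 2k + 1 as simulated memory and row 2k + 2 for its allocation; row 0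
  lists the jobs. The initial \<open>vBest\<close> is a row that is never written and stands for the
  empty allocation, with bound 0 / 1. The summand \<open>vN\<close> in \<open>vR\<close> lifts all
  rows above the output cells.\<close>

definition prepare :: "nat \<Rightarrow> com" where
  "prepare K =
     Set vN (Var 0) ;; Set vM (Var 1) ;; Set vB (Var 2) ;;
     Set vL (Mul (Const K) (Var vB)) ;;
     Set vLevels (Add (Add (Var vN) (Mul (Const 2) (Var vL))) (Const 1)) ;;
     Set vR (Add (Add (Mul (Const 2) (Var vLevels)) (Const 2)) (Var vN)) ;;
     Set vBest (Add (Mul (Const 2) (Var vLevels)) (Const 1)) ;;
     Set vP (Const 1) ;; Set vQ (Const 1) ;; Set vBQ (Const 1)"

definition power_body :: "nat \<Rightarrow> com" where
  "power_body K = Set vP (Mul (Var vP) (Const (K + 1))) ;; Set vQ (Mul (Var vQ) (Const K)) ;; Inc vJ"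

text \<open>Code 0 is the empty set. A query stores its answer in two consecutive cells, hence the
  adjacent numbers of \<open>vVP\<close> and \<open>vVQ\<close> and of \<open>vX\<close> and
  \<open>vY\<close>. The grid fraction advances only once the values of the empty set are used
  up.\<close>

definition choose_level :: "nat \<Rightarrow> com" where
  "choose_level K =
     If (Sub (Var vN) (Var vK))
       (Query (Const vVP) (Var vK) (Const 0))
       (Set vVP (Var vP) ;; Set vVQ (Var vQ) ;;
        If (Sub (Var vP) (Var vQ))
          (Set vP (Div (Var vP) (Const (K + 1))) ;; Set vQ (Div (Var vQ) (Const K)))
          (Set vP (Mul (Var vP) (Const K)) ;; Set vQ (Mul (Var vQ) (Const (K + 1))))) ;;
     Set vRow (Add (Mul (Const 2) (Var vK)) (Const 1)) ;; Set vRank (Const 0) ;; Set vJ (Const 0)"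

definition active_body :: com where
  "active_body =
     Query (Const vX) (Var vJ) (Const 0) ;;
     If (Less vX vY vVP vVQ)
       (Assign (Adr (Const 0) (Var vRank)) (Var vJ) ;; Inc vRank)
       Skip ;;
     Inc vJ"

text \<open>The length bound handed to the simulated run has to cover the truncation level, which
  may be returned as an answer: numerator and denominator of a grid level have at most (K + 1) * (L
  + 1) bits each.\<close>

definition start_run :: "nat \<Rightarrow> com" where
  "start_run K =
     Assign (Adr (Var vRow) (Const 0)) (Var vRank) ;;
     Assign (Adr (Var vRow) (Const 1)) (Var vM) ;;
     Assign (Adr (Var vRow) (Const 2))
       (Add (Var vB) (Mul (Const (2 * (K + 1))) (Add (Var vL) (Const 1))))"

text \<open>The fraction \<open>1 / 0\<close> serves as infinity.\<close>

definition start_min :: com where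
  "start_min = Set vMP (Const 1) ;; Set vMQ (Const 0) ;; Set vJ (Const 0) ;; Set vPos (Const 0)"

text \<open>The utilities come from the untruncated oracle, so the computed minimum is the true
  value of the allocation. \<open>vPos\<close> counts the remaining agents met so far and thereby
  points to the next job's set in the simulated output.\<close>

definition min_body :: com where
  "min_body =
     Query (Const vX) (Var vJ) (Const 0) ;;
     If (Less vX vY vVP vVQ)
       (Set vT (Cell (Var vRow) (Var vPos)) ;; Inc vPos)
       (Set vT (Const 0)) ;;
     Assign (Adr (Add (Var vRow) (Const 1)) (Var vJ)) (Var vT) ;;
     Query (Const vX) (Var vJ) (Var vT) ;;
     If (Less vX vY vMP vMQ) (Set vMP (Var vX) ;; Set vMQ (Var vY)) Skip ;;
     Inc vJ"

definition start_items :: com where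
  "start_items = Set vOk (Const 1) ;; Set vI (Const 0) ;; Set vPow (Const 1)"

definition start_count :: com where
  "start_count = Set vCnt (Const 0) ;; Set vJ (Const 0)"

text \<open>With \<open>vPow\<close> = 2 ^ i this adds bit i of the agent's code; the remainder
  modulo 2 is expressed through a division.\<close>

definition count_body :: com where
  "count_body =
     Set vT (Div (Cell (Add (Var vRow) (Const 1)) (Var vJ)) (Var vPow)) ;;
     Set vCnt (Add (Var vCnt) (Sub (Var vT) (Mul (Const 2) (Div (Var vT) (Const 2))))) ;;
     Inc vJ"

definition end_count :: "nat \<Rightarrow> com" where
  "end_count \<beta> =
     If (Sub (Var vCnt) (Const \<beta>)) (Set vOk (Const 0)) Skip ;;
     Inc vI ;; Set vPow (Mul (Const 2) (Var vPow))"

definition update_best :: com where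
  "update_best =
     If (Var vOk)
       (If (Less vBP vBQ vMP vMQ)
         (Set vBP (Var vMP) ;; Set vBQ (Var vMQ) ;; Set vBest (Add (Var vRow) (Const 1)))
         Skip)
       Skip ;;
     Inc vK"

definition agent_loop :: "com \<Rightarrow> com" where
  "agent_loop c = While (Sub (Var vN) (Var vJ)) c"

definition item_loop :: "nat \<Rightarrow> com" where
  "item_loop \<beta> = While (Sub (Var vM) (Var vI)) (start_count ;; agent_loop count_body ;; end_count \<beta>)"

definition level_body :: "nat \<Rightarrow> nat \<Rightarrow> com \<Rightarrow> com" where
  "level_body K \<beta> c =
     choose_level K ;; agent_loop active_body ;; start_run K ;; translate c ;;
     start_min ;; agent_loop min_body ;; start_items ;; item_loop \<beta> ;; update_best"

text \<open>
  The output overwrites the variables, so only the cells \<open>0\<close>, \<open>1\<close> and \<open>2\<close> are used while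
  it is written, and these receive their contents last.
\<close>

definition out_adr :: aexp where
  "out_adr = Add (Add (Const 40) (Mul (Var 1) (Add (Var 0) (Const 1)))) (Var 2)"

definition output_body :: com where
  "output_body = Set 0 (Sub (Var 0) (Const 1)) ;; Assign (Var 0) (Mem out_adr)"

definition write_output :: com where
  "write_output =
     (Set 0 (Var vN) ;; Set 1 (Var vR) ;; Set 2 (Var vBest)) ;;
     While (Sub (Var 0) (Const 3)) output_body ;;
     (Set 0 (Add (Add (Const 40) (Var 1)) (Var 2)) ;;
      Set 1 (Add (Var 1) (Var 0)) ;;
      Set 2 (Sub (Add (Var 1) (Var 1)) (Var 0)) ;;
      Set 0 (Mem (Var 0)) ;; Set 1 (Mem (Var 1)) ;; Set 2 (Mem (Var 2)))"

text \<open>Without items there are no machines, and the assignment algorithm promises nothing; the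
  output then consists of empty sets. Cell 1 contains m and is already 0 in that case.\<close>

definition mmfa_program :: "nat \<Rightarrow> nat \<Rightarrow> com \<Rightarrow> com" where
  "mmfa_program K \<beta> c =
     If (Var 1)
       (prepare K ;;
        While (Sub (Var vL) (Var vJ)) (power_body K) ;;
        While (Sub (Var vLevels) (Var vK)) (level_body K \<beta> c) ;;
        write_output)
       (Set 0 (Const 0) ;; Set 2 (Const 0))"

definition t_block :: "com \<Rightarrow> nat \<Rightarrow> nat" where
  "t_block c B = cweight c * (B + 1)"

text \<open>B also bounds the number of rounds of every loop, so that no other parameter of the
  instance enters the time bounds.\<close>

definition t_loop :: "aexp \<Rightarrow> nat \<Rightarrow> nat \<Rightarrow> nat" where
  "t_loop a B t = (B + 1) * (1 + aweight a * (B + 1) + t)"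

lemma runs_block: "wp \<Omega> B c Q s \<Longrightarrow> 1 \<le> B \<Longrightarrow> runs \<Omega> c s (t_block c B) Q"
  unfolding t_block_def by (rule runs_wp)

lemma runs_loop:
  assumes "I 0 s"
    and "\<And>i s. I i s \<Longrightarrow> i \<le> N \<Longrightarrow> reads_fit B a s \<and> (aval a s \<noteq> 0 \<longleftrightarrow> i < N)"
    and "\<And>i s. I i s \<Longrightarrow> i < N \<Longrightarrow> runs \<Omega> c s T (I (Suc i))"
    and "1 \<le> B" "N \<le> B"
  shows "runs \<Omega> (While a c) s (t_loop a B T) (I N)"
  unfolding t_loop_def
proof (rule runs_mono[OF runs_While[of I s N B a \<Omega> c T]])
  show "(N + 1) * (1 + aweight a * (B + 1) + T) \<le> (B + 1) * (1 + aweight a * (B + 1) + T)"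
    using assms(5) by (intro mult_right_mono) auto
qed (use assms in auto)

lemma same_except_upd [simp]:
  "x \<in> X \<Longrightarrow> same_except X s s' \<Longrightarrow> same_except X s (s'(x := v))"
  by (simp add: same_except_def)

lemma same_except_mono: "same_except X s s' \<Longrightarrow> X \<subseteq> Y \<Longrightarrow> same_except Y s s'"
  by (auto simp: same_except_def)

lemma same_exceptD: "same_except X s s' \<Longrightarrow> x \<notin> X \<Longrightarrow> s' x = s x"
  by (simp add: same_except_def)

lemma small_notin_range_adr [simp]: "x < 40 \<Longrightarrow> x \<notin> range (adr R r)"
  by (auto simp: adr_def)

lemma row_same_except: "same_except X s s' \<Longrightarrow> (\<And>a. adr R r a \<notin> X) \<Longrightarrow> row s' R r = row s R r"
  by (simp add: same_except_def row_def)

lemma set_decode_fits: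
  assumes "set_decode x \<subseteq> {..<m}"
  shows "fits m x"
proof -
  have "x \<le> set_encode {..<m}"
    using assms by (intro subset_decode_imp_le) simp
  also have "\<dots> < 2 ^ m"
    by (simp add: set_encode_def lessThan_atLeast0 sum_power2)
  finally show ?thesis by (simp add: fits_def)
qed

lemma card_less_Suc_Collect:
  "card {i. i < Suc j \<and> P i} = card {i. i < j \<and> P i} + of_bool (P j)"
proof -
  have "{i. i < Suc j \<and> P i} = (if P j then insert j {i. i < j \<and> P i} else {i. i < j \<and> P i})"
    by (auto simp: less_Suc_eq)
  then show ?thesis by simp
qed

lemma min_utility_Suc:
  "min_utility (Suc j) u T = (if j = 0 then u 0 (T 0) else min (u j (T j)) (min_utility j u T))"
  by (simp add: min_utility_def lessThan_Suc lessThan_empty_iff)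

text \<open>One bound for everything: B dominates the numbers of agents, levels and rows, the
  lengths of the numbers stored outside the simulated rows, and the size of the simulated instances.
  The square of K + 1 comes from (K + 1) * (L + 1) with L = K * b.\<close>

locale reduction =
  fixes n m b K \<beta> B :: nat and u :: "nat \<Rightarrow> nat set \<Rightarrow> real"
  assumes n: "0 < n" and m: "0 < m" and K: "1 \<le> K"
    and u: "\<And>j S. j < n \<Longrightarrow> S \<subseteq> {..<m} \<Longrightarrow>
      u j S \<in> \<rat> \<and> 0 \<le> u j S \<and> encoding_length (u j S) \<le> b"
    and B: "100 + 8 * (K + 1) * (K + 1) * (n + m + b + 1) + \<beta> \<le> B"
begin

definition "L = K * b"
definition "NL = n + 2 * L + 1"
definition "R = 2 * NL + 2 + n"

abbreviation "\<Omega> \<equiv> value_oracle n m u"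
abbreviation "V k \<equiv> level n u K b k"

lemma B_bounds: "100 \<le> B" "n \<le> B" "m + 1 \<le> B" "b \<le> B" "K + 1 \<le> B" "\<beta> \<le> B" "L \<le> B" "NL \<le> B"
  "R \<le> B" "b + 2 * (K + 1) * (L + 1) \<le> B" "2 * (K + 1) \<le> B" "(K + 1) * (L + 1) \<le> B"
  "n + m + (b + 2 * (K + 1) * (L + 1)) \<le> B"
proof -
  define x where "x = n + m + b + 1"
  define P where "P = (K + 1) * (K + 1) * x"
  have P1: "x \<le> P" by (simp add: P_def)
  have "K * b \<le> (K + 1) * x" by (intro mult_mono) (auto simp: x_def)
  also have "\<dots> \<le> P" unfolding P_def by (intro mult_right_mono) auto
  finally have P2: "L \<le> P" by (simp add: L_def)
  have "K * b + 1 \<le> (K + 1) * x" by (simp add: x_def algebra_simps)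
  then have "(K + 1) * (L + 1) \<le> (K + 1) * ((K + 1) * x)" unfolding L_def by (rule mult_left_mono) simp
  then have P3: "(K + 1) * (L + 1) \<le> P" by (simp only: P_def mult.assoc)
  have P4: "K + 1 \<le> (K + 1) * (L + 1)" by simp
  have B': "100 + 8 * P + \<beta> \<le> B" using B by (simp only: P_def x_def mult.assoc)
  define Y where "Y = (K + 1) * (L + 1)"
  have P5: "2 * (K + 1) * (L + 1) = 2 * ((K + 1) * (L + 1))" by (simp only: mult.assoc)
  show "100 \<le> B" "n \<le> B" "m + 1 \<le> B" "b \<le> B" "K + 1 \<le> B" "\<beta> \<le> B" "L \<le> B" "NL \<le> B"
    "R \<le> B" "b + 2 * (K + 1) * (L + 1) \<le> B" "2 * (K + 1) \<le> B" "(K + 1) * (L + 1) \<le> B"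
    "n + m + (b + 2 * (K + 1) * (L + 1)) \<le> B"
    unfolding P5 NL_def R_def using B' P1 P2 P3 P4 unfolding x_def
    by (simp_all only: Y_def[symmetric]) simp_all
qed

lemma fraction_fits:
  assumes "j < n" "S \<subseteq> {..<m}"
  shows "fits b (fst (fraction_of (u j S)))" "fits b (snd (fraction_of (u j S)))"
  using u[OF assms] by (auto simp: bit_length_le_iff[symmetric] encoding_length_def)

lemma answers_fit: "fits B (fst (\<Omega> j x)) \<and> fits B (snd (\<Omega> j x))"
  using fraction_fits B_bounds(1) by (auto simp: value_oracle_def intro!: fits_mono[OF _ B_bounds(4)])

lemma answer:
  assumes "j < n" "set_decode x \<subseteq> {..<m}"
  shows "ratio (\<Omega> j x) = u j (set_decode x)" "0 < snd (\<Omega> j x)"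
  using assms u[OF assms] by (auto simp: value_oracle_def ratio_def elim!: fraction_of_cases)

lemma less_iff_ratio_less:
  assumes "0 < snd x" "0 < snd y"
  shows "fst x * snd y < fst y * snd x \<longleftrightarrow> ratio x < ratio y"
proof -
  have "fst x * snd y < fst y * snd x \<longleftrightarrow>
      real (fst x) * real (snd y) < real (fst y) * real (snd x)"
    by (metis of_nat_less_iff of_nat_mult)
  then show ?thesis using assms by (simp add: ratio_def field_simps)
qed

text \<open>A level k < n is an answer of \<Omega>, of total length at most b; a grid level has two
  parts of at most (K + 1) * (L + 1) bits. The sum of both bounds covers either case.\<close>

lemma level_props:
  assumes "k < NL"
  shows "0 < snd (V k)" "coprime (fst (V k)) (snd (V k))" "0 \<le> ratio (V k)" "ratio (V k) \<in> \<rat>"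
    "fits B (fst (V k))" "fits B (snd (V k))"
    "encoding_length (ratio (V k)) \<le> b + 2 * (K + 1) * (L + 1)"
proof -
  have *: "0 < snd (V k) \<and> coprime (fst (V k)) (snd (V k)) \<and>
    fits (b + (K + 1) * (L + 1)) (fst (V k)) \<and> fits (b + (K + 1) * (L + 1)) (snd (V k)) \<and>
    bit_length (fst (V k)) + bit_length (snd (V k)) \<le> b + 2 * (K + 1) * (L + 1)"
  proof (cases "k < n")
    case True
    obtain p q where pq: "fraction_of (u k {}) = (p, q)" "0 < q" "coprime p q"
      using u[OF True, of "{}"] by (auto elim!: fraction_of_cases)
    have "bit_length p + bit_length q \<le> b"
      using u[OF True, of "{}"] pq by (simp add: encoding_length_def)
    then have "bit_length p + bit_length q \<le> b + 2 * (K + 1) * (L + 1)" by linarith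
    moreover have "fits b p" "fits b q"
      using fraction_fits[OF True, of "{}"] pq by auto
    ultimately show ?thesis using True pq
      by (auto simp: level_def intro: fits_mono simp del: mult_Suc mult_Suc_right)
  next
    case False
    let ?g = "grid K L (k - n)"
    have "fits ((K + 1) * (L + 1)) (fst ?g)" "fits ((K + 1) * (L + 1)) (snd ?g)"
      using assms by (intro grid_fits; simp add: NL_def)+
    moreover from this have "bit_length (fst ?g) + bit_length (snd ?g) \<le> (K + 1) * (L + 1) + (K + 1) * (L + 1)"
      unfolding bit_length_le_iff[symmetric] by (rule add_mono)
    moreover have "(K + 1) * (L + 1) + (K + 1) * (L + 1) \<le> b + 2 * (K + 1) * (L + 1)" by simp
    ultimately show ?thesis
      using False grid_lowest_terms[of K L "k - n"] grid_pos[OF K, of L "k - n"] fits_mono[of "(K + 1) * (L + 1)" _ "b + (K + 1) * (L + 1)"]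
      by (simp add: level_def L_def[symmetric] del: mult_Suc mult_Suc_right)
  qed
  have "b + (K + 1) * (L + 1) \<le> B" using B_bounds(10) by simp
  then show "0 < snd (V k)" "coprime (fst (V k)) (snd (V k))" "fits B (fst (V k))" "fits B (snd (V k))"
    using * by (auto intro: fits_mono)
  then have "fraction_of (ratio (V k)) = V k"
    using fraction_of_eqI[of "ratio (V k)" "fst (V k)" "snd (V k)"] by (simp add: ratio_def)
  then show "encoding_length (ratio (V k)) \<le> b + 2 * (K + 1) * (L + 1)"
    using * by (simp add: encoding_length_def)
qed (simp_all add: ratio_def)

section \<open>Runs of the blocks and loops that process one level\<close>

definition globals :: "memory \<Rightarrow> bool" where
  "globals s \<longleftrightarrow> s vN = n \<and> s vM = m \<and> s vB = b \<and> s vL = L \<and> s vLevels = NL \<and> s vR = R"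

lemma globals_same_except:
  "globals s \<Longrightarrow> same_except X s s' \<Longrightarrow> {vN, vM, vB, vL, vLevels, vR} \<inter> X = {} \<Longrightarrow> globals s'"
  by (auto simp: globals_def same_except_def)

lemma runs_choose_level:
  assumes "globals s" "s vK = k" "k < NL" "(s vP, s vQ) = grid K L (k - n)"
  shows "runs \<Omega> (choose_level K) s (t_block (choose_level K) B) (\<lambda>s'.
    same_except {vVP, vVQ, vP, vQ, vRow, vRank, vJ} s s' \<and>
    (s' vVP, s' vVQ) = V k \<and> (s' vP, s' vQ) = grid K L (Suc k - n) \<and>
    s' vRow = 2 * k + 1 \<and> s' vRank = 0 \<and> s' vJ = 0)"
proof (rule runs_block)
  have "fits ((K + 1) * (L + 1)) (fst (grid K L (k - n)))" "fits ((K + 1) * (L + 1)) (snd (grid K L (k - n)))"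
    using assms(3) by (intro grid_fits; simp add: NL_def)+
  then have f: "fits B (s vP)" "fits B (s vQ)"
    using assms(4)[symmetric] B_bounds by (auto intro: fits_mono)
  have gt: "s vQ < s vP \<longleftrightarrow> k - n < L"
    using grid_gt_iff[OF K, of L "k - n"] assms(4)[symmetric] by simp
  have step: "grid K L (Suc k - n) = (if k - n < L then (s vP div (K + 1), s vQ div K) else (s vP * K, s vQ * (K + 1)))"
    if "\<not> k < n"
    using grid_Suc[OF K, of L "k - n"] assms(4)[symmetric] that by (simp add: Suc_diff_le not_less)
  have k: "k \<le> B" using assms(3) B_bounds by simp
  show "wp \<Omega> B (choose_level K) (\<lambda>s'.
    same_except {vVP, vVQ, vP, vQ, vRow, vRank, vJ} s s' \<and>
    (s' vVP, s' vVQ) = V k \<and> (s' vP, s' vQ) = grid K L (Suc k - n) \<and>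
    s' vRow = 2 * k + 1 \<and> s' vRank = 0 \<and> s' vJ = 0) s"
  proof (cases "k < n")
    \<comment> \<open>By truncated subtraction \<open>k - n\<close> and \<open>Suc k - n\<close> are
      both 0: the grid has not started yet.\<close>
    case True
    then have "grid K L (Suc k - n) = (s vP, s vQ)" "V k = \<Omega> k 0"
      using assms(4) by (simp_all add: level_def value_oracle_def)
    then show ?thesis using assms(1,2) True k B_bounds answers_fit[of k 0]
      by (simp add: choose_level_def globals_def)
  next
    case False
    have "V k = (s vP, s vQ)" using False assms(4) by (simp add: level_def L_def)
    then show ?thesis using assms(1,2) False k B_bounds f gt step[OF False]
      by (auto simp: choose_level_def globals_def)
  qed
qed (use B_bounds in simp)

end

lemma length_active_list [simp]: "length (active_list u V j) = rank u V j"
  by (simp add: rank_def)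

lemma wp_mono: "wp \<Omega> B c Q s \<Longrightarrow> (\<And>s'. Q s' \<Longrightarrow> Q' s') \<Longrightarrow> wp \<Omega> B c Q' s"
proof (induction c arbitrary: s Q Q')
  case (Seq c d)
  from Seq.prems(1) have "wp \<Omega> B c (wp \<Omega> B d Q) s" by simp
  then have "wp \<Omega> B c (wp \<Omega> B d Q') s"
    by (rule Seq.IH(1)) (rule Seq.IH(2)[OF _ Seq.prems(2)])
  then show ?case by simp
next
  case (If a c d)
  from If.prems(1) show ?case by (auto intro: If.IH[OF _ If.prems(2)])
qed auto

definition t_item :: "nat \<Rightarrow> nat \<Rightarrow> nat" where
  "t_item \<beta> B = 1 + t_block start_count B + (1 + t_loop (Sub (Var vN) (Var vJ)) B (t_block count_body B) +
    t_block (end_count \<beta>) B)"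

context reduction
begin

lemmas Bs = B_bounds(1-9)

lemma R_pos: "0 < R"
  by (simp add: R_def)

lemma runs_active_loop:
  assumes s: "globals s" "(s vVP, s vVQ) = W" "s vRank = 0" "s vJ = 0"
    and W: "0 < snd W" "fits B (fst W)" "fits B (snd W)"
  shows "runs \<Omega> (agent_loop active_body) s (t_loop (Sub (Var vN) (Var vJ)) B (t_block active_body B)) (\<lambda>s'.
    same_except ({vX, vY, vRank, vJ} \<union> range (adr R 0)) s s' \<and>
    s' vRank = rank u (ratio W) n \<and>
    (\<forall>i < rank u (ratio W) n. row s' R 0 i = active_list u (ratio W) n ! i))"
proof -
  let ?X = "{vX, vY, vRank, vJ} \<union> range (adr R 0)"
  define I where "I = (\<lambda>j t. same_except ?X s t \<and> t vJ = j \<and> t vRank = rank u (ratio W) j \<and>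
    (\<forall>i < rank u (ratio W) j. row t R 0 i = active_list u (ratio W) j ! i))"
  have env: "globals t" "t vVP = fst W" "t vVQ = snd W" "t vJ = j" if "I j t" for j t
    using that s globals_same_except[of s ?X t] by (auto simp: I_def same_except_def)
  have "runs \<Omega> (agent_loop active_body) s (t_loop (Sub (Var vN) (Var vJ)) B (t_block active_body B)) (I n)"
    unfolding agent_loop_def
  proof (rule runs_loop)
    show "I 0 s" using s by (simp add: I_def)
  next
    fix j t assume j: "I j t" "j < n"
    let ?a = "\<Omega> j 0"
    have a: "fst ?a * snd W < fst W * snd ?a \<longleftrightarrow> u j {} < ratio W"
      using less_iff_ratio_less[of ?a W] answer[OF j(2), of 0] W(1) by simp
    have "rank u (ratio W) j \<le> B" using rank_le[of u "ratio W" j] j(2) Bs by simp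
    then show "runs \<Omega> active_body t (t_block active_body B) (I (Suc j))"
      using env[OF j(1)] j Bs R_pos W answers_fit[of j 0] a
      by (intro runs_block)
        (auto simp: active_body_def I_def globals_def active_list_Suc nth_append less_Suc_eq)
  next
    fix j t assume j: "I j t" "j \<le> n"
    show "reads_fit B (Sub (Var vN) (Var vJ)) t \<and> (aval (Sub (Var vN) (Var vJ)) t \<noteq> 0 \<longleftrightarrow> j < n)"
      using env[OF j(1)] j(2) Bs by (auto simp: globals_def)
  qed (use Bs in auto)
  then show ?thesis by (rule runs_mono) (auto simp: I_def)
qed

text \<open>Writing three cells suffices because the row is still all zero, as the simulated program
  expects.\<close>

lemma runs_start_run:
  assumes "globals s" "s vRow = r" "r < R" "row s R r = (\<lambda>_. 0)" "fits B (s vRank)"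
  shows "runs \<Omega> (start_run K) s (t_block (start_run K) B) (\<lambda>s'.
    same_except (range (adr R r)) s s' \<and>
    row s' R r = initial_memory (s vRank) m (b + 2 * (K + 1) * (L + 1)))"
proof (rule runs_block)
  show "wp \<Omega> B (start_run K) (\<lambda>s'. same_except (range (adr R r)) s s' \<and>
    row s' R r = initial_memory (s vRank) m (b + 2 * (K + 1) * (L + 1))) s"
    using assms Bs B_bounds(11) by (simp add: start_run_def globals_def initial_memory_def)
qed (use Bs in simp)

lemma runs_min_loop:
  fixes W :: "nat \<times> nat" and v :: memory
  defines "w \<equiv> \<lambda>j. if u j {} < ratio W then v (rank u (ratio W) j) else 0"
  assumes s: "globals s" "(s vVP, s vVQ) = W" "s vRow = r" "r + 1 < R"
      "row s R r = v" "row s R (r + 1) = (\<lambda>_. 0)"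
      "s vMP = 1" "s vMQ = 0" "s vJ = 0" "s vPos = 0"
    and W: "0 < snd W" "fits B (fst W)" "fits B (snd W)"
    and v: "\<And>i. i < rank u (ratio W) n \<Longrightarrow> set_decode (v i) \<subseteq> {..<m}"
  shows "runs \<Omega> (agent_loop min_body) s (t_loop (Sub (Var vN) (Var vJ)) B (t_block min_body B)) (\<lambda>s'.
    same_except ({vX, vY, vT, vMP, vMQ, vJ, vPos} \<union> range (adr R (r + 1))) s s' \<and>
    row s' R (r + 1) = (\<lambda>j. if j < n then w j else 0) \<and>
    fits B (s' vMP) \<and> fits B (s' vMQ) \<and> 0 < s' vMQ \<and>
    ratio (s' vMP, s' vMQ) = min_utility n u (\<lambda>j. set_decode (w j)))"
proof -
  let ?X = "{vX, vY, vT, vMP, vMQ, vJ, vPos} \<union> range (adr R (r + 1))"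
  let ?T = "\<lambda>j. set_decode (w j)"
  define I where "I = (\<lambda>j t. same_except ?X s t \<and> t vJ = j \<and> t vPos = rank u (ratio W) j \<and>
    row t R (r + 1) = (\<lambda>i. if i < j then w i else 0) \<and>
    fits B (t vMP) \<and> fits B (t vMQ) \<and>
    (if j = 0 then t vMP = 1 \<and> t vMQ = 0
     else 0 < t vMQ \<and> ratio (t vMP, t vMQ) = min_utility j u ?T))"
  have w: "set_decode (w j) \<subseteq> {..<m}" if "j < n" for j
    using v active_list_rank(1)[of j n u "ratio W"] that by (simp add: w_def)
  have env: "globals t" "t vVP = fst W" "t vVQ = snd W" "t vRow = r" "row t R r = v" "t vJ = j" if "I j t" for j t
  proof -
    have se: "same_except ?X s t" using that by (simp add: I_def)
    show "globals t" by (rule globals_same_except[OF s(1) se]) auto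
    show "t vVP = fst W" "t vVQ = snd W" "t vRow = r"
      using same_exceptD[OF se, of vVP] same_exceptD[OF se, of vVQ] same_exceptD[OF se, of vRow] s by auto
    show "t vJ = j" using that by (simp add: I_def)
    show "row t R r = v"
      using s(4,5) by (subst row_same_except[OF se]) auto
  qed
  have "runs \<Omega> (agent_loop min_body) s (t_loop (Sub (Var vN) (Var vJ)) B (t_block min_body B)) (I n)"
    unfolding agent_loop_def
  proof (rule runs_loop)
    show "I 0 s" using s Bs by (simp add: I_def)
  next
    fix j t assume j: "I j t" "j < n"
    let ?a = "\<Omega> j 0" and ?c = "\<Omega> j (w j)"
    have a: "fst ?a * snd W < fst W * snd ?a \<longleftrightarrow> u j {} < ratio W"
      using less_iff_ratio_less[of ?a W] answer[OF j(2), of 0] W(1) by simp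
    have c: "0 < snd ?c" "ratio ?c = u j (?T j)" using answer[OF j(2) w[OF j(2)]] by auto
    \<comment> \<open>For j = 0 the current minimum is 1 / 0, so the comparison reads 0 <
      \<open>snd ?c\<close> and succeeds for any first utility.\<close>
    have cmp: "fst ?c * t vMQ < t vMP * snd ?c \<longleftrightarrow> j = 0 \<or> u j (?T j) < min_utility j u ?T"
    proof (cases "j = 0")
      case True
      then have "t vMP = 1" "t vMQ = 0" using j(1) by (simp_all add: I_def)
      then show ?thesis using True c by simp
    next
      case False
      then have "0 < t vMQ" "ratio (t vMP, t vMQ) = min_utility j u ?T" using j(1) by (simp_all add: I_def)
      then show ?thesis using False less_iff_ratio_less[of ?c "(t vMP, t vMQ)"] c by simp
    qed
    have wj: "fits B (w j)"
      using set_decode_fits[OF w[OF j(2)]] Bs by (auto intro: fits_mono)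
    have rank: "rank u (ratio W) j \<le> B" using rank_le[of u "ratio W" j] j(2) Bs by simp
    have rc: "ratio (fst ?c, snd ?c) = u j (?T j)" using c by simp
    have upd: "(\<lambda>i. if i < j then w i else 0)(j := w j) = (\<lambda>i. if i < Suc j then w i else 0)"
      by (auto simp: less_Suc_eq)
    have r: "r \<le> B" using s(4) Bs by simp
    have It: "same_except ?X s t" "t vJ = j" "t vPos = rank u (ratio W) j"
      "row t R (r + 1) = (\<lambda>i. if i < j then w i else 0)" "fits B (t vMP)" "fits B (t vMQ)"
      "j \<noteq> 0 \<Longrightarrow> 0 < t vMQ \<and> ratio (t vMP, t vMQ) = min_utility j u ?T"
      using j(1) by (auto simp: I_def)
    show "runs \<Omega> min_body t (t_block min_body B) (I (Suc j))"
    proof (rule runs_block)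
      \<comment> \<open>The state once the code of agent j is in \<open>vT\<close>; the body is
        verified in two halves joined by \<open>wp_mono\<close>.\<close>
      define mid where "mid = (\<lambda>t'. same_except ?X s t' \<and> globals t' \<and> t' vJ = j \<and> t' vRow = r \<and>
        t' vT = w j \<and> t' vPos = rank u (ratio W) (Suc j) \<and>
        row t' R (r + 1) = (\<lambda>i. if i < j then w i else 0) \<and> t' vMP = t vMP \<and> t' vMQ = t vMQ)"
      have 1: "wp \<Omega> B (Query (Const vX) (Var vJ) (Const 0) ;;
          If (Less vX vY vVP vVQ)
            (Set vT (Cell (Var vRow) (Var vPos)) ;; Inc vPos) (Set vT (Const 0))) mid t"
        using env[OF j(1)] It j(2) Bs W answers_fit[of j 0] a wj rank s(4) r
        by (auto simp: mid_def globals_def w_def)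
      have 2: "wp \<Omega> B (Assign (Adr (Add (Var vRow) (Const 1)) (Var vJ)) (Var vT) ;;
          Query (Const vX) (Var vJ) (Var vT) ;;
          If (Less vX vY vMP vMQ) (Set vMP (Var vX) ;; Set vMQ (Var vY)) Skip ;; Inc vJ) (I (Suc j)) t'"
        if "mid t'" for t'
        using that It(5-7) j(2) Bs answers_fit[of j "w j"] cmp c rc wj s(4) r upd
        by (auto simp: mid_def I_def globals_def min_utility_Suc)
      show "wp \<Omega> B min_body (I (Suc j)) t"
        using wp_mono[OF 1, of "wp \<Omega> B _ (I (Suc j))", OF 2] unfolding min_body_def wp.simps .
    qed (use Bs in simp)
  next
    fix j t assume j: "I j t" "j \<le> n"
    show "reads_fit B (Sub (Var vN) (Var vJ)) t \<and> (aval (Sub (Var vN) (Var vJ)) t \<noteq> 0 \<longleftrightarrow> j < n)"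
      using env[OF j(1)] j(2) Bs by (auto simp: globals_def)
  qed (use Bs in auto)
  then show ?thesis by (rule runs_mono) (use n in \<open>auto simp: I_def\<close>)
qed

lemma runs_count_loop:
  fixes w :: "nat \<Rightarrow> nat"
  assumes s: "globals s" "s vRow = r" "r + 1 < R" "row s R (r + 1) = (\<lambda>j. if j < n then w j else 0)"
      "s vPow = 2 ^ i" "i < m" "s vCnt = 0" "s vJ = 0"
    and w: "\<And>j. j < n \<Longrightarrow> set_decode (w j) \<subseteq> {..<m}"
  shows "runs \<Omega> (agent_loop count_body) s (t_loop (Sub (Var vN) (Var vJ)) B (t_block count_body B)) (\<lambda>s'.
    same_except {vT, vCnt, vJ} s s' \<and> s' vCnt = card {j. j < n \<and> i \<in> set_decode (w j)})"
proof -
  let ?X = "{vT, vCnt, vJ}"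
  define I where "I = (\<lambda>j t. same_except ?X s t \<and> t vJ = j \<and>
    t vCnt = card {j'. j' < j \<and> i \<in> set_decode (w j')})"
  have env: "globals t" "t vRow = r" "t vPow = 2 ^ i" "row t R (r + 1) = (\<lambda>j. if j < n then w j else 0)"
      "t vJ = j" if "I j t" for j t
  proof -
    have se: "same_except ?X s t" using that by (simp add: I_def)
    show "globals t" by (rule globals_same_except[OF s(1) se]) auto
    show "t vRow = r" "t vPow = 2 ^ i"
      using same_exceptD[OF se, of vRow] same_exceptD[OF se, of vPow] s by auto
    show "t vJ = j" using that by (simp add: I_def)
    show "row t R (r + 1) = (\<lambda>j. if j < n then w j else 0)"
      using s(4) by (subst row_same_except[OF se]) auto
  qed
  have "runs \<Omega> (agent_loop count_body) s (t_loop (Sub (Var vN) (Var vJ)) B (t_block count_body B)) (I n)"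
    unfolding agent_loop_def
  proof (rule runs_loop)
    show "I 0 s" using s by (simp add: I_def)
  next
    fix j t assume j: "I j t" "j < n"
    have wj: "fits B (w j)"
      using set_decode_fits[OF w[OF j(2)]] Bs by (auto intro: fits_mono)
    then have wd: "fits B (w j div 2 ^ i)" by (rule fits_le) (rule div_le_dividend)
    have pow: "fits B (2 ^ i)" using s(6) Bs by (simp add: fits_def)
    have "card {j'. j' < j \<and> i \<in> set_decode (w j')} \<le> card {..<j}" by (intro card_mono) auto
    then have cnt: "t vCnt \<le> B" using j Bs by (simp add: I_def)
    have bit: "x - 2 * (x div 2) = of_bool (odd x)" for x :: nat
      by (simp add: minus_mult_div_eq_mod mod_2_eq_odd)
    have mem: "i \<in> set_decode x \<longleftrightarrow> odd (x div 2 ^ i)" for x by (simp add: set_decode_def)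
    have It: "same_except ?X s t" "t vCnt = card {j'. j' < j \<and> i \<in> set_decode (w j')}"
      using j(1) by (simp_all add: I_def)
    have r: "r \<le> B" using s(3) Bs by simp
    show "runs \<Omega> count_body t (t_block count_body B) (I (Suc j))"
      using env[OF j(1)] j(2) Bs wj wd pow cnt It r s(3)
      by (intro runs_block)
        (simp_all add: count_body_def I_def globals_def card_less_Suc_Collect bit mem[of "w j"])
  next
    fix j t assume j: "I j t" "j \<le> n"
    show "reads_fit B (Sub (Var vN) (Var vJ)) t \<and> (aval (Sub (Var vN) (Var vJ)) t \<noteq> 0 \<longleftrightarrow> j < n)"
      using env[OF j(1)] j(2) Bs by (auto simp: globals_def)
  qed (use Bs in auto)
  then show ?thesis by (rule runs_mono) (auto simp: I_def)
qed

lemma runs_item_loop: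
  fixes w :: "nat \<Rightarrow> nat"
  assumes s: "globals s" "s vRow = r" "r + 1 < R" "row s R (r + 1) = (\<lambda>j. if j < n then w j else 0)"
      "s vPow = 1" "s vOk = 1" "s vI = 0"
    and w: "\<And>j. j < n \<Longrightarrow> set_decode (w j) \<subseteq> {..<m}"
  shows "runs \<Omega> (item_loop \<beta>) s (t_loop (Sub (Var vM) (Var vI)) B (t_item \<beta> B)) (\<lambda>s'.
    same_except {vT, vCnt, vJ, vPow, vOk, vI} s s' \<and> s' vOk \<le> 1 \<and>
    (s' vOk \<noteq> 0 \<longleftrightarrow> (\<forall>i<m. card {j. j < n \<and> i \<in> set_decode (w j)} \<le> \<beta>)))"
proof -
  let ?X = "{vT, vCnt, vJ, vPow, vOk, vI}"
  let ?card = "\<lambda>i. card {j. j < n \<and> i \<in> set_decode (w j)}"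
  define I where "I = (\<lambda>i t. same_except ?X s t \<and> t vI = i \<and> t vPow = 2 ^ i \<and> t vOk \<le> 1 \<and>
    (t vOk \<noteq> 0 \<longleftrightarrow> (\<forall>i'<i. ?card i' \<le> \<beta>)))"
  have env: "globals t" "t vRow = r" "row t R (r + 1) = (\<lambda>j. if j < n then w j else 0)" "t vI = i"
    if "I i t" for i t
  proof -
    have se: "same_except ?X s t" using that by (simp add: I_def)
    show "globals t" by (rule globals_same_except[OF s(1) se]) auto
    show "t vRow = r" using same_exceptD[OF se, of vRow] s by auto
    show "t vI = i" using that by (simp add: I_def)
    show "row t R (r + 1) = (\<lambda>j. if j < n then w j else 0)"
      using s(4) by (subst row_same_except[OF se]) auto
  qed
  have "runs \<Omega> (item_loop \<beta>) s (t_loop (Sub (Var vM) (Var vI)) B (t_item \<beta> B)) (I m)"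
    unfolding item_loop_def
  proof (rule runs_loop)
    show "I 0 s" using s by (simp add: I_def)
  next
    fix i t assume i: "I i t" "i < m"
    note env = env[OF i(1)]
    have 1: "runs \<Omega> start_count t (t_block start_count B) (\<lambda>t'. t' = t(vCnt := 0, vJ := 0))"
      using Bs by (intro runs_block) (simp_all add: start_count_def)
    show "runs \<Omega> (start_count ;; agent_loop count_body ;; end_count \<beta>) t (t_item \<beta> B) (I (Suc i))"
      unfolding t_item_def
    proof (rule runs_Seq[OF 1], rule runs_Seq)
      fix t' assume t': "t' = t(vCnt := 0, vJ := 0)"
      have "globals t'" using env(1) t' by (simp add: globals_def)
      then show "runs \<Omega> (agent_loop count_body) t' (t_loop (Sub (Var vN) (Var vJ)) B (t_block count_body B))
          (\<lambda>s'. same_except {vT, vCnt, vJ} t' s' \<and> s' vCnt = ?card i)"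
        using env i s(3) w t' by (intro runs_count_loop[of _ r]) (auto simp: I_def)
      fix t'' assume t'': "same_except {vT, vCnt, vJ} t' t'' \<and> t'' vCnt = ?card i"
      have se: "same_except {vT, vCnt, vJ} t t''"
        using t'' t' by (auto simp: same_except_def)
      then have "same_except ?X t t''" by (rule same_except_mono) auto
      then have se': "same_except ?X s t''"
        using i(1) same_except_trans by (auto simp: I_def)
      have eq: "t'' vI = i" "t'' vPow = 2 ^ i" "t'' vOk = t vOk" "t'' vCnt = ?card i"
        using same_exceptD[OF se, of vI] same_exceptD[OF se, of vPow] same_exceptD[OF se, of vOk] i(1) t''
        by (auto simp: I_def)
      have ok: "t vOk \<le> 1" "t vOk \<noteq> 0 \<longleftrightarrow> (\<forall>i'<i. ?card i' \<le> \<beta>)" using i(1) by (simp_all add: I_def)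
      have "?card i \<le> card {..<n}" by (intro card_mono) auto
      then have c: "?card i \<le> B" using Bs by simp
      have pow: "fits B (2 ^ i)" using i(2) Bs by (simp add: fits_def)
      show "runs \<Omega> (end_count \<beta>) t'' (t_block (end_count \<beta>) B) (I (Suc i))"
        using eq ok c pow se' Bs i(2)
        by (intro runs_block) (auto simp: end_count_def I_def less_Suc_eq not_le)
    qed
  next
    fix i t assume i: "I i t" "i \<le> m"
    show "reads_fit B (Sub (Var vM) (Var vI)) t \<and> (aval (Sub (Var vM) (Var vI)) t \<noteq> 0 \<longleftrightarrow> i < m)"
      using env[OF i(1)] i(2) Bs by (auto simp: globals_def)
  qed (use Bs in auto)
  then show ?thesis by (rule runs_mono) (auto simp: I_def)
qed

end

context reduction
begin

definition job_oracle :: "nat \<Rightarrow> oracle_fun" where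
  "job_oracle k = value_oracle (rank u (ratio (V k)) n) m (speeds n u (ratio (V k)))"

lemma runs_simulation:
  assumes k: "k < NL" and s: "sim_env R r (V k) (active_list u (ratio (V k)) n) s" "row s R r = v"
    and r: "0 < r" "r < R"
    and c: "exec (job_oracle k) c v t v'" "t \<le> Tc"
  shows "runs \<Omega> (translate c) s (2 * cweight (translate c) * (B + 1) * Tc)
    (\<lambda>s'. row s' R r = v' \<and> same_except (sim_cells R r) s s')"
proof -
  interpret simulation \<Omega> "job_oracle k" B R r "V k" "active_list u (ratio (V k)) n"
  proof unfold_locales
    show "job_oracle k j x = (if j < length (active_list u (ratio (V k)) n)
        then clip (V k) (\<Omega> (active_list u (ratio (V k)) n ! j) x) else (0, 1))" for j x
      unfolding job_oracle_def using u level_props[OF k] by (intro value_oracle_speeds) auto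
    show "fits B (length (active_list u (ratio (V k)) n))"
      using rank_le[of u "ratio (V k)" n] Bs by simp
    show "fits B (active_list u (ratio (V k)) n ! i)" if "i < length (active_list u (ratio (V k)) n)" for i
      using active_list_nth(1)[of i u "ratio (V k)" n] that Bs by simp
    show "fits B r" using r Bs by simp
  qed (use Bs level_props[OF k] answers_fit r in auto)
  obtain t' s' where 1: "exec \<Omega> (translate c) s t' s'" "t' \<le> 2 * cweight (translate c) * (B + 1) * t"
    "row s' R r = v'" "same_except (sim_cells R r) s s'"
    using exec_translate[OF c(1) order_refl s] by blast
  have "t' \<le> 2 * cweight (translate c) * (B + 1) * Tc"
    using 1(2) mult_left_mono[OF c(2), of "2 * cweight (translate c) * (B + 1)"] by linarith
  then show ?thesis using 1 by (intro runsI) auto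
qed

section \<open>Good levels and the invariant of the main loop\<close>

definition opt :: real where
  "opt = optimal_utility n m u"

text \<open>What \<open>induced_allocation_approximates\<close> asks of a level, with V' the
  optimum. Goodness is never tested; it is enough that some level has it. If the optimum is 0, none
  does.\<close>

definition good :: "nat \<Rightarrow> bool" where
  "good k \<longleftrightarrow> 0 < opt \<and> opt \<le> ratio (V k) \<and> ratio (V k) * real K < (real K + 1) * opt \<and>
     (\<forall>j<n. u j {} < ratio (V k) \<longrightarrow> u j {} < opt)"

definition allocation_code :: "nat \<Rightarrow> memory \<Rightarrow> nat \<Rightarrow> nat" where
  "allocation_code k v j = (if u j {} < ratio (V k) then v (rank u (ratio (V k)) j) else 0)"

lemma set_decode_allocation_code:
  "set_decode (allocation_code k v j) = induced_allocation u (ratio (V k)) (output_family v) j"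
  by (simp add: allocation_code_def induced_allocation_def output_family_def)

end

text \<open>The algorithm's guarantee is assumed for all levels, good or not: a bad level must
  neither ruin the time bound nor produce sets outside the items. The inequality between \<alpha>, K
  and \<beta> ensures that a level within the factor (K + 1) / K of the optimum overloads no
  item.\<close>

locale reduction_run = reduction +
  fixes c :: com and Tc :: nat and \<alpha> :: real
  assumes \<alpha>: "1 \<le> \<alpha>" "\<alpha> * (real K + 1) \<le> (real \<beta> + 1) * real K"
    and alg: "\<And>k. k < NL \<Longrightarrow> \<exists>t v.
      exec (job_oracle k) c (initial_memory (rank u (ratio (V k)) n) m (b + 2 * (K + 1) * (L + 1))) t v \<and>
      t \<le> Tc \<and> output_family v \<in> assignments (rank u (ratio (V k)) n) m \<and>
      load (rank u (ratio (V k)) n) m (speeds n u (ratio (V k))) (output_family v) \<le>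
        ennreal \<alpha> * optimal_load (rank u (ratio (V k)) n) m (speeds n u (ratio (V k)))"
begin

lemma good_allocation:
  assumes k: "k < NL" "good k"
    and v: "output_family v \<in> assignments (rank u (ratio (V k)) n) m"
      "load (rank u (ratio (V k)) n) m (speeds n u (ratio (V k))) (output_family v) \<le>
        ennreal \<alpha> * optimal_load (rank u (ratio (V k)) n) m (speeds n u (ratio (V k)))"
  shows "(\<lambda>j. set_decode (allocation_code k v j)) \<in> augmented_allocations \<beta> n m"
    and "opt / \<alpha> \<le> min_utility n u (\<lambda>j. set_decode (allocation_code k v j))"
proof -
  obtain T where T: "T \<in> allocations n m" "min_utility n u T = opt"
    using optimal_utility_attained[OF n] unfolding opt_def by metis
  have T': "opt \<le> u j (T j)" if "j < n" for j
    using min_utility_ge_iff[OF n, of opt u T] T(2) that by simp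
  have "\<alpha> * ratio (V k) * real K < \<alpha> * ((real K + 1) * opt)"
    using k(2) \<alpha>(1) by (simp add: good_def mult.assoc)
  also have "\<dots> = (\<alpha> * (real K + 1)) * opt" by simp
  also have "\<dots> \<le> (real \<beta> + 1) * real K * opt"
    using \<alpha>(2) k(2) by (intro mult_right_mono) (auto simp: good_def)
  finally have "\<alpha> * ratio (V k) * real K < (real \<beta> + 1) * opt * real K" by (simp add: ac_simps)
  then have lt: "\<alpha> * ratio (V k) < (real \<beta> + 1) * opt"
    by (rule mult_right_less_imp_less) simp
  note * = induced_allocation_approximates[of opt "ratio (V k)" \<alpha> \<beta> m n u T "output_family v"]
  show "(\<lambda>j. set_decode (allocation_code k v j)) \<in> augmented_allocations \<beta> n m"
    unfolding set_decode_allocation_code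
    using *(1) k(2) lt m \<alpha>(1) u T(1) T' v by (simp add: good_def)
  show "opt / \<alpha> \<le> min_utility n u (\<lambda>j. set_decode (allocation_code k v j))"
    unfolding set_decode_allocation_code min_utility_ge_iff[OF n]
    using *(2) k(2) lt m \<alpha>(1) u T(1) T' v by (simp add: good_def)
qed

definition best :: "memory \<Rightarrow> nat \<Rightarrow> nat set" where
  "best s = (\<lambda>j. set_decode (row s R (s vBest) j))"

text \<open>The stored bound need not be the exact value of the best allocation, as it starts with 0
  for the empty one. The best row belongs to an earlier level or is the untouched row
  \<open>2 * NL + 1\<close>, so the next level does not overwrite it; the rows from 2k + 1 on are
  still zero, ready for fresh runs. The last clause carries the approximation guarantee.\<close>

definition invar :: "nat \<Rightarrow> memory \<Rightarrow> bool" where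
  "invar k s \<longleftrightarrow> globals s \<and> s vK = k \<and> (s vP, s vQ) = grid K L (k - n) \<and>
     (\<forall>r. 2 * k + 1 \<le> r \<longrightarrow> r < R \<longrightarrow> row s R r = (\<lambda>_. 0)) \<and>
     0 < s vBest \<and> s vBest < R \<and> (s vBest \<le> 2 * k \<or> s vBest = 2 * NL + 1) \<and>
     (\<forall>j. fits m (row s R (s vBest) j)) \<and>
     best s \<in> augmented_allocations \<beta> n m \<and>
     fits B (s vBP) \<and> fits B (s vBQ) \<and> 0 < s vBQ \<and>
     ratio (s vBP, s vBQ) \<le> min_utility n u (best s) \<and>
     (\<forall>k'<k. good k' \<longrightarrow> opt / \<alpha> \<le> ratio (s vBP, s vBQ))"

lemma runs_update_best:
  assumes k: "k < NL" and inv: "invar k s"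
    and v: "output_family v \<in> assignments (rank u (ratio (V k)) n) m"
      "load (rank u (ratio (V k)) n) m (speeds n u (ratio (V k))) (output_family v) \<le>
        ennreal \<alpha> * optimal_load (rank u (ratio (V k)) n) m (speeds n u (ratio (V k)))"
    and frame: "\<And>x. x \<in> {vN, vM, vB, vL, vLevels, vR, vK, vBest, vBP, vBQ} \<Longrightarrow> s' x = s x"
      "\<And>r. r < R \<Longrightarrow> r \<notin> {0, 2 * k + 1, 2 * k + 2} \<Longrightarrow> row s' R r = row s R r"
    and s': "(s' vP, s' vQ) = grid K L (Suc k - n)" "s' vRow = 2 * k + 1"
      "row s' R (2 * k + 2) = (\<lambda>j. if j < n then allocation_code k v j else 0)"
      "fits B (s' vMP)" "fits B (s' vMQ)" "0 < s' vMQ"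
      "ratio (s' vMP, s' vMQ) = min_utility n u (\<lambda>j. set_decode (allocation_code k v j))"
      "s' vOk \<le> 1"
      "s' vOk \<noteq> 0 \<longleftrightarrow> (\<forall>i<m. card {j. j < n \<and> i \<in> set_decode (allocation_code k v j)} \<le> \<beta>)"
  shows "runs \<Omega> update_best s' (t_block update_best B) (invar (Suc k))"
proof -
  let ?w = "allocation_code k v"
  let ?T = "\<lambda>j. set_decode (?w j)"
  have w: "?T j \<subseteq> {..<m}" if "j < n" for j
    using induced_allocation_subset[OF v(1) that] by (simp add: set_decode_allocation_code)
  have ok: "s' vOk \<noteq> 0 \<longleftrightarrow> ?T \<in> augmented_allocations \<beta> n m"
    using w s'(9) by (auto simp: augmented_allocations_def Pi_def)
  have k2: "2 * k + 2 < R" using k by (simp add: R_def)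
  have "s vBest < R" "0 < s vBest" "s vBest \<le> 2 * k \<or> s vBest = 2 * NL + 1"
    using inv by (auto simp: invar_def)
  \<comment> \<open>As k < NL, the row \<open>2 * NL + 1\<close> lies beyond the rows of level
    k.\<close>
  moreover from this(3) have "s vBest \<noteq> 2 * k + 1" "s vBest \<noteq> 2 * k + 2" using k by presburger+
  ultimately have best_row: "row s' R (s' vBest) = row s R (s vBest)"
    using frame(1)[of vBest] frame(2)[of "s vBest"] by simp
  have fresh: "row s' R r = (\<lambda>_. 0)" if "2 * Suc k + 1 \<le> r" "r < R" for r
    using inv that frame(2)[of r] by (auto simp: invar_def)
  have cmp: "s' vBP * s' vMQ < s' vMP * s' vBQ \<longleftrightarrow> ratio (s' vBP, s' vBQ) < min_utility n u ?T"
    using less_iff_ratio_less[of "(s' vBP, s' vBQ)" "(s' vMP, s' vMQ)"] s'(6,7) inv frame(1)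
    by (simp add: invar_def)
  define upd where "upd = (s' vOk \<noteq> 0 \<and> ratio (s' vBP, s' vBQ) < min_utility n u ?T)"
  define s'' where "s'' = (if upd then s'(vBP := s' vMP, vBQ := s' vMQ, vBest := 2 * k + 2, vK := Suc k)
    else s'(vK := Suc k))"
  have fit: "fits B (s' vBP)" "fits B (s' vBQ)" "s' vK = k"
    using inv frame(1) by (simp_all add: invar_def)
  have "runs \<Omega> update_best s' (t_block update_best B) (\<lambda>t. t = s'')"
    using Bs k k2 fit s'(2,4,5,8) cmp
    by (intro runs_block) (auto simp: update_best_def s''_def upd_def)
  moreover have "invar (Suc k) s''"
  proof (cases upd)
    case True
    then have T: "?T \<in> augmented_allocations \<beta> n m" "ratio (s' vBP, s' vBQ) < min_utility n u ?T"
      using ok by (auto simp: upd_def)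
    have row: "row s'' R (s'' vBest) = (\<lambda>j. if j < n then ?w j else 0)"
      using True s'(3) by (simp add: s''_def)
    have best: "best s'' j = (if j < n then ?T j else {})" for j
      by (simp add: best_def row)
    have bestT: "best s'' \<in> augmented_allocations \<beta> n m"
      using T(1) by (auto simp: augmented_allocations_def Pi_def best cong: conj_cong)
    have minT: "min_utility n u (best s'') = min_utility n u ?T"
      unfolding min_utility_def by (simp add: best cong: image_cong_simp)
    have fitm: "fits m (row s'' R (s'' vBest) j)" for j
      using set_decode_fits[OF w] by (simp add: row)
    have old: "opt / \<alpha> \<le> ratio (s'' vBP, s'' vBQ)" if "k' < Suc k" "good k'" for k'
    proof (cases "k' < k")
      case True
      then have "opt / \<alpha> \<le> ratio (s' vBP, s' vBQ)" using inv that frame(1) by (simp add: invar_def)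
      then show ?thesis using T(2) s'(7) \<open>upd\<close> by (simp add: s''_def)
    next
      case False
      then have "k' = k" using that by simp
      then show ?thesis using good_allocation(2)[OF k _ v] that s'(7) \<open>upd\<close> by (simp add: s''_def)
    qed
    show ?thesis
      unfolding invar_def using bestT minT fitm old fresh True inv frame(1) s' k2
      by (auto simp: s''_def invar_def globals_def)
  next
    case False
    have row: "row s'' R (s'' vBest) = row s R (s vBest)"
      using False best_row by (simp add: s''_def)
    have best: "best s'' = best s" by (simp add: best_def row)
    have old: "opt / \<alpha> \<le> ratio (s'' vBP, s'' vBQ)" if "k' < Suc k" "good k'" for k'
    proof (cases "k' < k")
      case True
      then show ?thesis using inv that frame(1) False by (simp add: invar_def s''_def)
    next
      \<comment> \<open>A good level passes the item test, so an update is refused only if the old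
        bound is at least as large.\<close>
      case k': False
      then have g: "good k" using that by (simp add: less_Suc_eq)
      then have "min_utility n u ?T \<le> ratio (s' vBP, s' vBQ)"
        using False ok good_allocation(1)[OF k g v] by (simp add: upd_def)
      then show ?thesis using good_allocation(2)[OF k g v] False by (simp add: s''_def)
    qed
    show ?thesis
      unfolding invar_def using best row old fresh False inv frame(1) s'(1)
      by (auto simp: s''_def invar_def globals_def)
  qed
  ultimately show ?thesis by (auto intro: runs_mono)
qed

end

definition t_level :: "nat \<Rightarrow> nat \<Rightarrow> com \<Rightarrow> nat \<Rightarrow> nat \<Rightarrow> nat" where
  "t_level K \<beta> c B Tc =
     1 + t_block (choose_level K) B +
     (1 + t_loop (Sub (Var vN) (Var vJ)) B (t_block active_body B) +
     (1 + t_block (start_run K) B +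
     (1 + 2 * cweight (translate c) * (B + 1) * Tc +
     (1 + t_block start_min B +
     (1 + t_loop (Sub (Var vN) (Var vJ)) B (t_block min_body B) +
     (1 + t_block start_items B +
     (1 + t_loop (Sub (Var vM) (Var vI)) B (t_item \<beta> B) +
     t_block update_best B)))))))"

lemma in_sim_cells_iff: "x < 40 \<Longrightarrow> x \<in> sim_cells R r \<longleftrightarrow> x \<in> {vX, vY, vD, vA, vS}"
  by (simp add: sim_cells_def)

lemma adr_in_sim_cells_iff: "r < R \<Longrightarrow> r' < R \<Longrightarrow> adr R r' a \<in> sim_cells R r \<longleftrightarrow> r' = r"
  by (auto simp: sim_cells_def)

lemma adr_in_range_iff [simp]: "r < R \<Longrightarrow> r' < R \<Longrightarrow> adr R r' a \<in> range (adr R r) \<longleftrightarrow> r' = r"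
  by auto

lemma runs_Seq_eq:
  "runs \<Omega> c s T (\<lambda>s'. s' = s1) \<Longrightarrow> runs \<Omega> c' s1 T' Q \<Longrightarrow> runs \<Omega> (c ;; c') s (1 + T + T') Q"
  by (erule runs_Seq) simp

context reduction_run
begin

lemma runs_level_body:
  assumes k: "k < NL" and inv: "invar k s"
  shows "runs \<Omega> (level_body K \<beta> c) s (t_level K \<beta> c B Tc) (invar (Suc k))"
proof -
  let ?r = "2 * k + 1" and ?W = "V k" and ?n = "rank u (ratio (V k)) n"
  let ?X = "{vVP, vVQ, vP, vQ, vRow, vRank, vJ, vX, vY, vT, vMP, vMQ, vPos, vD, vA, vS, vCnt, vPow, vOk, vI}
    \<union> range (adr R 0) \<union> range (adr R ?r) \<union> range (adr R (?r + 1))"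
  have r: "?r + 1 < R" "?r < R" "0 < R" using k by (simp_all add: R_def)
  obtain t v where v: "exec (job_oracle k) c (initial_memory ?n m (b + 2 * (K + 1) * (L + 1))) t v" "t \<le> Tc"
    "output_family v \<in> assignments ?n m"
    "load ?n m (speeds n u (ratio ?W)) (output_family v) \<le>
        ennreal \<alpha> * optimal_load ?n m (speeds n u (ratio ?W))"
    using alg[OF k] by blast
  have vsub: "set_decode (v i) \<subseteq> {..<m}" if "i < ?n" for i
    using v(3) that by (auto simp: assignments_def output_family_def Pi_def)
  have wsub: "set_decode (allocation_code k v j) \<subseteq> {..<m}" if "j < n" for j
    using induced_allocation_subset[OF v(3) that] by (simp add: set_decode_allocation_code)
  have n_le: "?n \<le> B" using rank_le[of u "ratio ?W" n] Bs by simp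
  note lp = level_props[OF k]
  have g: "globals s" and s: "s vK = k" "(s vP, s vQ) = grid K L (k - n)"
    and zero: "row s R ?r = (\<lambda>_. 0)" "row s R (?r + 1) = (\<lambda>_. 0)"
    using inv r by (auto simp: invar_def)
  show ?thesis
    unfolding level_body_def t_level_def
  proof (rule runs_Seq[OF runs_choose_level[OF g s(1) k s(2)]], elim conjE, rule runs_Seq)
    fix s1
    assume se1: "same_except {vVP, vVQ, vP, vQ, vRow, vRank, vJ} s s1"
      and s1: "(s1 vVP, s1 vVQ) = ?W" "(s1 vP, s1 vQ) = grid K L (Suc k - n)" "s1 vRow = ?r"
        "s1 vRank = 0" "s1 vJ = 0"
    have g1: "globals s1" by (rule globals_same_except[OF g se1]) auto
    have z1: "row s1 R ?r = (\<lambda>_. 0)" "row s1 R (?r + 1) = (\<lambda>_. 0)"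
      using zero by (simp_all add: row_same_except[OF se1])
    let ?X2 = "{vX, vY, vRank, vJ} \<union> range (adr R 0)"
    show "runs \<Omega> (agent_loop active_body) s1 (t_loop (Sub (Var vN) (Var vJ)) B (t_block active_body B))
      (\<lambda>s'. same_except ?X2 s1 s' \<and> s' vRank = ?n \<and> (\<forall>i<?n. row s' R 0 i = active_list u (ratio ?W) n ! i))"
      by (rule runs_active_loop[OF g1 s1(1,4,5) lp(1,5,6)])
    fix s2
    assume "same_except ?X2 s1 s2 \<and> s2 vRank = ?n \<and> (\<forall>i<?n. row s2 R 0 i = active_list u (ratio ?W) n ! i)"
    then have se2: "same_except ?X2 s1 s2"
      and s2: "s2 vRank = ?n" "\<And>i. i < ?n \<Longrightarrow> row s2 R 0 i = active_list u (ratio ?W) n ! i" by auto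
    have g2: "globals s2" by (rule globals_same_except[OF g1 se2]) auto
    have z2: "row s2 R ?r = (\<lambda>_. 0)" "row s2 R (?r + 1) = (\<lambda>_. 0)"
      using z1 r by (simp_all add: row_same_except[OF se2])
    have e2: "s2 vVP = s1 vVP" "s2 vVQ = s1 vVQ" "s2 vP = s1 vP" "s2 vQ = s1 vQ" "s2 vRow = s1 vRow"
      by (auto intro: same_exceptD[OF se2])
    have "s2 vRow = ?r" using e2 s1 by simp
    note st3 = runs_start_run[OF g2 this r(2) z2(1)]
    show "runs \<Omega> (start_run K ;; translate c ;; start_min ;; agent_loop min_body ;; start_items ;;
        item_loop \<beta> ;; update_best) s2
      (1 + t_block (start_run K) B + (1 + 2 * cweight (translate c) * (B + 1) * Tc +
       (1 + t_block start_min B + (1 + t_loop (Sub (Var vN) (Var vJ)) B (t_block min_body B) +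
       (1 + t_block start_items B + (1 + t_loop (Sub (Var vM) (Var vI)) B (t_item \<beta> B) +
        t_block update_best B)))))) (invar (Suc k))"
    proof (rule runs_Seq[OF st3], goal_cases)
      case 1
      show ?case using s2(1) n_le by simp
    next
      case (2 s3)
      then have se3: "same_except (range (adr R ?r)) s2 s3"
        and s3: "row s3 R ?r = initial_memory ?n m (b + 2 * (K + 1) * (L + 1))" by (auto simp: s2(1))
      have g3: "globals s3" by (rule globals_same_except[OF g2 se3]) auto
      have e3: "s3 x = s2 x" if "x < 40" for x using that by (intro same_exceptD[OF se3]) auto
      have row0: "row s3 R 0 = row s2 R 0" using r by (intro row_same_except[OF se3]) simp
      have z3: "row s3 R (?r + 1) = (\<lambda>_. 0)"
        using z2 r by (subst row_same_except[OF se3]) simp_all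
      have env: "sim_env R ?r ?W (active_list u (ratio ?W) n) s3"
        using g3 e3 e2 s1(1)[symmetric] s1(3) s2 row0 by (simp add: sim_env_def globals_def)
      show ?case
      proof (rule runs_Seq[OF runs_simulation[OF k env s3 _ r(2) v(1,2)]], goal_cases)
        case 1
        show ?case by simp
      next
        case (2 s4)
        then have s4: "row s4 R ?r = v" and se4: "same_except (sim_cells R ?r) s3 s4" by auto
        have g4: "globals s4" by (rule globals_same_except[OF g3 se4]) (auto simp: in_sim_cells_iff)
        have e4: "s4 x = s3 x" if "x < 40" "x \<notin> {vX, vY, vD, vA, vS}" for x
          using that by (intro same_exceptD[OF se4]) (simp add: in_sim_cells_iff)
        have z4: "row s4 R (?r + 1) = (\<lambda>_. 0)"
          using z3 r by (subst row_same_except[OF se4]) (simp_all add: adr_in_sim_cells_iff)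
        define s5 where "s5 = s4(vMP := 1, vMQ := 0, vJ := 0, vPos := 0)"
        have st5: "runs \<Omega> start_min s4 (t_block start_min B) (\<lambda>s'. s' = s5)"
          using Bs by (intro runs_block) (simp_all add: start_min_def s5_def)
        have g5: "globals s5" using g4 by (simp add: s5_def globals_def)
        have s5: "(s5 vVP, s5 vVQ) = ?W" "s5 vRow = ?r" "row s5 R ?r = v" "row s5 R (?r + 1) = (\<lambda>_. 0)"
          "s5 vMP = 1" "s5 vMQ = 0" "s5 vJ = 0" "s5 vPos = 0"
          using e4 e3 e2 s1 s4 z4 by (simp_all add: s5_def)
        note st6 = runs_min_loop[OF g5 s5(1,2) r(1) s5(3-8) lp(1,5,6) vsub]
        show ?case
        proof (rule runs_Seq_eq[OF st5], rule runs_Seq[OF st6], goal_cases)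
          case (1 i)
          then show ?case .
        next
          case (2 s6)
          let ?X6 = "{vX, vY, vT, vMP, vMQ, vJ, vPos} \<union> range (adr R (?r + 1))"
          from 2 have se6: "same_except ?X6 s5 s6"
            and s6: "row s6 R (?r + 1) = (\<lambda>j. if j < n then allocation_code k v j else 0)"
              "fits B (s6 vMP)" "fits B (s6 vMQ)" "0 < s6 vMQ"
              "ratio (s6 vMP, s6 vMQ) = min_utility n u (\<lambda>j. set_decode (allocation_code k v j))"
            by (auto simp: allocation_code_def[abs_def])
          have g6: "globals s6" by (rule globals_same_except[OF g5 se6]) auto
          define s7 where "s7 = s6(vOk := 1, vI := 0, vPow := 1)"
          have st7: "runs \<Omega> start_items s6 (t_block start_items B) (\<lambda>s'. s' = s7)"
            using Bs by (intro runs_block) (simp_all add: start_items_def s7_def)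
          have g7: "globals s7" using g6 by (simp add: s7_def globals_def)
          have e6: "s6 vRow = ?r" "s6 vP = s5 vP" "s6 vQ = s5 vQ"
            using s5(2) by (auto simp: same_exceptD[OF se6])
          have s7: "s7 vRow = ?r" "row s7 R (?r + 1) = (\<lambda>j. if j < n then allocation_code k v j else 0)"
            "s7 vPow = 1" "s7 vOk = 1" "s7 vI = 0"
            using e6 s6(1) by (simp_all add: s7_def)
          note st8 = runs_item_loop[OF g7 s7(1) r(1) s7(2-5) wsub]
          show ?case
          proof (rule runs_Seq_eq[OF st7], rule runs_Seq[OF st8], goal_cases)
            case (1 j)
            then show ?case .
          next
            case (2 s8)
            let ?X8 = "{vT, vCnt, vJ, vPow, vOk, vI}"
            from 2 have se8: "same_except ?X8 s7 s8" and ok: "s8 vOk \<le> 1"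
              "s8 vOk \<noteq> 0 \<longleftrightarrow> (\<forall>i<m. card {j. j < n \<and> i \<in> set_decode (allocation_code k v j)} \<le> \<beta>)"
              by auto
            have e8: "s8 x = s6 x" if "x \<notin> ?X8" for x
              using same_exceptD[OF se8 that] that by (simp add: s7_def)
            \<comment> \<open>Composing the frame conditions of the blocks; of the rows, only 0, 2k
              + 1 and 2k + 2 may have been touched.\<close>
            have "same_except ?X s s1" using se1 by (rule same_except_mono) auto
            moreover have "same_except ?X s1 s2" using se2 by (rule same_except_mono) auto
            moreover have "same_except ?X s2 s3" using se3 by (rule same_except_mono) auto
            moreover have "same_except ?X s3 s4" using se4 by (rule same_except_mono) (auto simp: sim_cells_def)
            moreover have "same_except ?X s4 s5" by (simp add: s5_def)
            moreover have "same_except ?X s5 s6" using se6 by (rule same_except_mono) auto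
            moreover have "same_except ?X s6 s7" by (simp add: s7_def)
            moreover have "same_except ?X s7 s8" using se8 by (rule same_except_mono) auto
            ultimately have se: "same_except ?X s s8" by (meson same_except_trans)
            show ?case
            proof (rule runs_update_best[OF k inv v(3,4)])
              show "s8 x = s x" if "x \<in> {vN, vM, vB, vL, vLevels, vR, vK, vBest, vBP, vBQ}" for x
                using that by (intro same_exceptD[OF se]) auto
              show "row s8 R r' = row s R r'" if "r' < R" "r' \<notin> {0, 2 * k + 1, 2 * k + 2}" for r'
                using that r by (intro row_same_except[OF se]) simp
              show "(s8 vP, s8 vQ) = grid K L (Suc k - n)"
                using s1(2) e2 e3 e4 e6 by (simp add: e8 s5_def)
              show "s8 vRow = 2 * k + 1" using e6 by (simp add: e8)
              have "row s8 R (?r + 1) = row s7 R (?r + 1)" by (rule row_same_except[OF se8]) simp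
              then show "row s8 R (2 * k + 2) = (\<lambda>j. if j < n then allocation_code k v j else 0)"
                using s7(2) by simp
            qed (use s6 ok in \<open>simp_all add: e8\<close>)
          qed
        qed
      qed
    qed
  qed
qed

end

text \<open>When the output is written, addresses are cell contents. They are at most 40 + 4 * R,
  which may exceed B but not 5 * B.\<close>

lemma fits_if_le_mult:
  assumes "x \<le> 5 * B" "100 \<le> B"
  shows "fits B x"
proof -
  define d where "d = B - 3"
  then have d: "B = d + 3" using assms(2) by simp
  have "5 * (d + 3) < 8 * x" if "d < x" for x using that assms(2) d by simp
  then have "5 * (d + 3) < 8 * 2 ^ d" using less_exp by blast
  then show ?thesis using assms(1) d by (simp add: fits_def power_add)
qed

lemma runs_IfTrue:
  assumes "reads_fit B a s" "aval a s \<noteq> 0" "1 \<le> B" "runs \<Omega> c s T Q"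
  shows "runs \<Omega> (If a c d) s (1 + aweight a * (B + 1) + T) Q"
proof -
  obtain t s' where 1: "exec \<Omega> c s t s'" "t \<le> T" "Q s'" using assms(4) unfolding runs_def by blast
  have "1 + acost a s + t \<le> 1 + aweight a * (B + 1) + T"
    using acost_le[OF assms(1,3)] 1(2) by linarith
  then show ?thesis by (rule runsI[OF exec.IfTrue[OF assms(2) 1(1)]]) (rule 1(3))
qed

section \<open>Assembling the whole program\<close>

definition t_main :: "nat \<Rightarrow> nat \<Rightarrow> com \<Rightarrow> nat \<Rightarrow> nat \<Rightarrow> nat" where
  "t_main K \<beta> c B Tc =
     1 + aweight (Var 1) * (B + 1) +
     (1 + t_block (prepare K) B +
     (1 + t_loop (Sub (Var vL) (Var vJ)) B (t_block (power_body K) B) +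
     (1 + t_loop (Sub (Var vLevels) (Var vK)) B (t_level K \<beta> c B Tc) +
     (1 + t_block (Set 0 (Var vN) ;; Set 1 (Var vR) ;; Set 2 (Var vBest)) B +
     (1 + t_loop (Sub (Var 0) (Const 3)) B (t_block output_body B) +
      t_block (Set 0 (Add (Add (Const 40) (Var 1)) (Var 2)) ;; Set 1 (Add (Var 1) (Var 0)) ;;
        Set 2 (Sub (Add (Var 1) (Var 1)) (Var 0)) ;;
        Set 0 (Mem (Var 0)) ;; Set 1 (Mem (Var 1)) ;; Set 2 (Mem (Var 2))) B)))))"

context reduction_run
begin

definition start_state :: "memory \<Rightarrow> bool" where
  "start_state s \<longleftrightarrow> globals s \<and> s vK = 0 \<and> s vJ = 0 \<and> s vP = 1 \<and> s vQ = 1 \<and> s vBP = 0 \<and> s vBQ = 1 \<and>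
     s vBest = 2 * NL + 1 \<and> (\<forall>r. row s R r = (\<lambda>_. 0))"

lemma runs_prepare:
  "runs \<Omega> (prepare K) (initial_memory n m b) (t_block (prepare K) B) start_state"
proof (rule runs_block)
  have "row (initial_memory n m b) R r = (\<lambda>_. 0)" for r
    by (simp add: row_def initial_memory_def adr_def fun_eq_iff)
  moreover have "Suc (n + 2 * L) = NL" "Suc (Suc (Suc (Suc (3 * n + 4 * L)))) = R"
    "Suc (Suc (2 * n + 4 * L)) = 2 * NL"
    by (simp_all add: NL_def R_def)
  ultimately show "wp \<Omega> B (prepare K) start_state (initial_memory n m b)"
    using Bs by (simp add: prepare_def start_state_def globals_def initial_memory_def L_def[symmetric])
qed (use Bs in simp)

lemma runs_power_loop:
  assumes s: "start_state s"
  shows "runs \<Omega> (While (Sub (Var vL) (Var vJ)) (power_body K)) s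
    (t_loop (Sub (Var vL) (Var vJ)) B (t_block (power_body K) B)) (invar 0)"
proof -
  let ?X = "{vP, vQ, vJ}"
  define I where "I = (\<lambda>j t. same_except ?X s t \<and> t vJ = j \<and> t vP = (K + 1) ^ j \<and> t vQ = K ^ j)"
  have env: "globals t" "t vJ = j" "t vP = (K + 1) ^ j" "t vQ = K ^ j" if "I j t" for j t
    using that s globals_same_except[of s ?X t] by (auto simp: I_def start_state_def)
  have "runs \<Omega> (While (Sub (Var vL) (Var vJ)) (power_body K)) s
    (t_loop (Sub (Var vL) (Var vJ)) B (t_block (power_body K) B)) (I L)"
  proof (rule runs_loop)
    show "I 0 s" using s by (simp add: I_def start_state_def)
  next
    fix j t assume j: "I j t" "j < L"
    \<comment> \<open>The intermediate powers are grid entries themselves, so their lengths are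
      known.\<close>
    have "grid K L (L - j) = ((K + 1) ^ j, K ^ j)" using j(2) by (cases "j = 0") (simp_all add: grid_def)
    then have "fits ((K + 1) * (L + 1)) ((K + 1) ^ j)" "fits ((K + 1) * (L + 1)) (K ^ j)"
      using grid_fits[of "L - j" L K] by simp_all
    then have "fits B ((K + 1) ^ j)" "fits B (K ^ j)" using B_bounds(12) by (auto intro: fits_mono)
    then have f: "fits B (t vP)" "fits B (t vQ)" using env[OF j(1)] by simp_all
    have "same_except ?X s t" using j(1) by (simp add: I_def)
    then have "wp \<Omega> B (power_body K) (I (Suc j)) t"
      using env[OF j(1)] j(2) Bs f by (simp add: power_body_def I_def mult.commute)
    then show "runs \<Omega> (power_body K) t (t_block (power_body K) B) (I (Suc j))"
      using Bs by (intro runs_block) simp_all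
  next
    fix j t assume j: "I j t" "j \<le> L"
    show "reads_fit B (Sub (Var vL) (Var vJ)) t \<and> (aval (Sub (Var vL) (Var vJ)) t \<noteq> 0 \<longleftrightarrow> j < L)"
      using env[OF j(1)] j(2) Bs by (auto simp: globals_def)
  qed (use Bs in auto)
  moreover have "invar 0 t" if I: "I L t" for t
  proof -
    have se: "same_except ?X s t" using I by (simp add: I_def)
    have row: "row t R r = (\<lambda>_. 0)" for r
      using s row_same_except[OF se, of R r] by (simp add: start_state_def)
    have e: "t vK = 0" "t vBP = 0" "t vBQ = 1" "t vBest = 2 * NL + 1"
      using s by (simp_all add: same_exceptD[OF se] start_state_def)
    have "best t = (\<lambda>_. {})" by (simp add: best_def row)
    \<comment> \<open>Utilities are nonnegative, so the initial bound 0 / 1 is correct for the empty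
      allocation.\<close>
    moreover have "0 \<le> min_utility n u (\<lambda>_. {})"
      unfolding min_utility_ge_iff[OF n] using u by auto
    ultimately show ?thesis
      using env[OF I] e row Bs by (simp add: invar_def grid_0 R_def augmented_allocations_def ratio_def)
  qed
  ultimately show ?thesis by (auto intro: runs_mono)
qed

lemma adr_gt: "n < adr R r a"
  by (simp add: adr_def R_def)

lemma runs_write_output:
  assumes inv: "invar NL s"
  shows "runs \<Omega> write_output s
    (1 + t_block (Set 0 (Var vN) ;; Set 1 (Var vR) ;; Set 2 (Var vBest)) B +
     (1 + t_loop (Sub (Var 0) (Const 3)) B (t_block output_body B) +
      t_block (Set 0 (Add (Add (Const 40) (Var 1)) (Var 2)) ;; Set 1 (Add (Var 1) (Var 0)) ;;
        Set 2 (Sub (Add (Var 1) (Var 1)) (Var 0)) ;;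
        Set 0 (Mem (Var 0)) ;; Set 1 (Mem (Var 1)) ;; Set 2 (Mem (Var 2))) B))
    (\<lambda>s'. \<forall>j<n. s' j = row s R (s vBest) j)"
proof -
  define \<rho> where "\<rho> = s vBest"
  have \<rho>: "\<rho> < R" using inv by (simp add: invar_def \<rho>_def)
  have g: "s vN = n" "s vR = R" using inv by (simp_all add: invar_def globals_def)
  have fit: "fits B (row s R \<rho> j)" for j
    using inv Bs unfolding \<rho>_def by (auto simp: invar_def intro: fits_mono[of m])
  \<comment> \<open>The cells are filled from \<open>n - 1\<close> down to 3, with cell 0 as counter
    and the cells 1 and 2 holding R and the best row; no row is hit because all rows lie above
    n.\<close>
  define I where "I = (\<lambda>i t. t 0 = n - i \<and> t 1 = R \<and> t 2 = \<rho> \<and>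
    (\<forall>j. n - i \<le> j \<longrightarrow> 3 \<le> j \<longrightarrow> j < n \<longrightarrow> t j = row s R \<rho> j) \<and> row t R \<rho> = row s R \<rho>)"
  have 1: "runs \<Omega> (Set 0 (Var vN) ;; Set 1 (Var vR) ;; Set 2 (Var vBest)) s
      (t_block (Set 0 (Var vN) ;; Set 1 (Var vR) ;; Set 2 (Var vBest)) B) (I 0)"
    using g \<rho> Bs by (intro runs_block) (auto simp: I_def \<rho>_def)
  have row_upd: "row (t(x := v)) R r = row t R r" if "x < n \<or> x < 40" for t x v r
  proof -
    have "adr R r a \<noteq> x" for a using that adr_gt[of r a] by (auto simp: adr_def)
    then show ?thesis by (simp add: row_def)
  qed
  have body: "runs \<Omega> output_body t (t_block output_body B) (I (Suc i))" if I: "I i t" and i: "i < n - 3" for i t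
  proof (rule runs_block)
    let ?j = "n - Suc i"
    have j: "3 \<le> ?j" "?j < n" "n - i = Suc ?j" using i by simp_all
    have "t (adr R \<rho> ?j) = row s R \<rho> ?j" using I by (auto simp: I_def row_def fun_eq_iff)
    then have val: "t (40 + R * (?j + 1) + \<rho>) = row s R \<rho> ?j" by (simp add: adr_def)
    have It: "t 0 = n - i" "t 1 = R" "t 2 = \<rho>" "row t R \<rho> = row s R \<rho>"
      "\<And>j. n - i \<le> j \<Longrightarrow> 3 \<le> j \<Longrightarrow> j < n \<Longrightarrow> t j = row s R \<rho> j" using I by (auto simp: I_def)
    define t' where "t' = t(0 := ?j, ?j := row s R \<rho> ?j)"
    have "I (Suc i) t'"
      unfolding I_def
    proof (intro conjI allI impI)
      fix j' assume j': "n - Suc i \<le> j'" "3 \<le> j'" "j' < n"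
      show "t' j' = row s R \<rho> j'"
        using It(5)[of j'] j' j by (cases "j' = ?j") (auto simp: t'_def)
    qed (use It j row_upd in \<open>auto simp: t'_def\<close>)
    moreover have "aval (Mem out_adr) (t(0 := ?j)) = row s R \<rho> ?j"
      using It val j by (simp add: out_adr_def)
    moreover have "reads_fit B (Mem out_adr) (t(0 := ?j))"
      using calculation(2) It j Bs \<rho> fit[of ?j] by (simp add: out_adr_def)
    moreover have "reads_fit B (Sub (Var 0) (Const 1)) t" "aval (Sub (Var 0) (Const 1)) t = ?j"
      using It Bs j by simp_all
    moreover have fj: "fits B ?j" using j(2) Bs(2) by (intro fits_if_le) linarith
    ultimately show "wp \<Omega> B output_body (I (Suc i)) t"
      using j Bs by (simp add: output_body_def t'_def fj)
  qed (use Bs in simp)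
  have 2: "runs \<Omega> (While (Sub (Var 0) (Const 3)) output_body) t
      (t_loop (Sub (Var 0) (Const 3)) B (t_block output_body B)) (I (n - 3))" if "I 0 t" for t
  proof (rule runs_loop[where I = I and N = "n - 3"])
    show "I 0 t" by (rule that)
    show "reads_fit B (Sub (Var 0) (Const 3)) t \<and> (aval (Sub (Var 0) (Const 3)) t \<noteq> 0 \<longleftrightarrow> i < n - 3)"
      if "I i t" "i \<le> n - 3" for i t
    proof -
      have "t 0 = n - i" using that(1) by (simp add: I_def)
      moreover have "n - i \<le> B" using Bs(2) by linarith
      ultimately show ?thesis using that(2) Bs(1) by auto
    qed
  qed (use body Bs in auto)
  show ?thesis
    unfolding write_output_def
  proof (rule runs_Seq[OF 1], rule runs_Seq[OF 2], assumption)
    fix t assume I: "I (n - 3) t"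
    let ?a = "adr R \<rho>"
    let ?t' = "t(0 := ?a 0, 1 := ?a 1, 2 := ?a 2, 0 := row s R \<rho> 0, 1 := row s R \<rho> 1, 2 := row s R \<rho> 2)"
    have It: "t 1 = R" "t 2 = \<rho>" "row t R \<rho> = row s R \<rho>"
      "\<And>j. 3 \<le> j \<Longrightarrow> j < n \<Longrightarrow> t j = row s R \<rho> j" using I by (auto simp: I_def)
    \<comment> \<open>The three remaining addresses form an arithmetic progression with difference
      R, so the cells 0, 1 and 2 suffice to hold all of them before any is dereferenced.\<close>
    have adr: "40 + R + \<rho> = ?a 0" "R + ?a 0 = ?a 1" "?a 1 + ?a 1 - ?a 0 = ?a 2"
      by (simp_all add: adr_def)
    have fa: "fits B (?a 0)" "fits B (?a 1)" "fits B (?a 2)"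
      using \<rho> Bs by (auto intro!: fits_if_le_mult simp: adr_def)
    have ta: "t (?a j) = row s R \<rho> j" for j using It(3) by (metis row_def)
    have "\<forall>j<n. ?t' j = row s R \<rho> j"
      using It(4) by (auto simp: numeral_2_eq_2 numeral_3_eq_3 less_Suc_eq_le not_le)
    then show "runs \<Omega> (Set 0 (Add (Add (Const 40) (Var 1)) (Var 2)) ;; Set 1 (Add (Var 1) (Var 0)) ;;
        Set 2 (Sub (Add (Var 1) (Var 1)) (Var 0)) ;;
        Set 0 (Mem (Var 0)) ;; Set 1 (Mem (Var 1)) ;; Set 2 (Mem (Var 2))) t
      (t_block (Set 0 (Add (Add (Const 40) (Var 1)) (Var 2)) ;; Set 1 (Add (Var 1) (Var 0)) ;;
        Set 2 (Sub (Add (Var 1) (Var 1)) (Var 0)) ;;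
        Set 0 (Mem (Var 0)) ;; Set 1 (Mem (Var 1)) ;; Set 2 (Mem (Var 2))) B)
      (\<lambda>s'. \<forall>j<n. s' j = row s R (s vBest) j)"
      unfolding \<rho>_def[symmetric]
      using It \<rho> Bs adr fa ta fit by (intro runs_block) simp_all
  qed
qed

text \<open>A positive optimum is a value \<open>u j S\<close> = p / q with p \<ge> 1 and p, q < 2 ^
  b, which places it in the range that \<open>exists_good_level\<close> asks for.\<close>

lemma exists_good: "0 < opt \<Longrightarrow> \<exists>k<NL. good k"
proof -
  assume pos: "0 < opt"
  obtain T where T: "T \<in> allocations n m" "min_utility n u T = opt"
    using optimal_utility_attained[OF n] unfolding opt_def by metis
  have "opt \<in> (\<lambda>j. u j (T j)) ` {..<n}"
    unfolding T(2)[symmetric] min_utility_def using n by (intro Min_in) auto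
  then obtain j where j: "j < n" "opt = u j (T j)" by auto
  have sub: "T j \<subseteq> {..<m}" using T(1) j(1) by (auto simp: augmented_allocations_def)
  obtain p q where pq: "fraction_of opt = (p, q)" "opt = real p / real q" "0 < q"
    using u[OF j(1) sub] j(2) by (auto elim!: fraction_of_cases)
  have "p < 2 ^ b" "q < 2 ^ b"
    using fraction_fits[OF j(1) sub] pq(1) j(2) by (simp_all add: fits_def)
  then have f: "real p < 2 ^ b" "real q < 2 ^ b" by (simp_all add: numeral_power_eq_of_nat_cancel_iff flip: of_nat_less_iff)
  have "1 \<le> real p" using pos pq by (cases p) auto
  have "1 * real q < real p * 2 ^ b"
    using f(2) \<open>1 \<le> real p\<close> pq(3) by (intro mult_le_less_imp_less) auto
  then have "1 < opt * 2 ^ b" unfolding pq(2) using pq(3) by (simp add: field_simps)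
  moreover have "opt \<le> real p"
    unfolding pq(2) using pq(3) divide_left_mono[of 1 "real q" "real p"] by simp
  then have "opt \<le> 2 ^ b" using f(1) by linarith
  ultimately have "\<exists>k < n + 2 * (K * b) + 1. opt \<le> ratio (V k) \<and>
      ratio (V k) * real K < (real K + 1) * opt \<and> (\<forall>j<n. u j {} < ratio (V k) \<longrightarrow> u j {} < opt)"
    using u by (intro exists_good_level[OF K]) auto
  then show ?thesis using pos by (auto simp: good_def NL_def L_def)
qed

lemma runs_mmfa_program:
  "runs \<Omega> (mmfa_program K \<beta> c) (initial_memory n m b) (t_main K \<beta> c B Tc) (\<lambda>s.
    output_family s \<in> augmented_allocations \<beta> n m \<and>
    optimal_utility n m u / \<alpha> \<le> min_utility n u (output_family s))"
  unfolding mmfa_program_def t_main_def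
proof (rule runs_IfTrue)
  have loop: "runs \<Omega> (While (Sub (Var vLevels) (Var vK)) (level_body K \<beta> c)) s
      (t_loop (Sub (Var vLevels) (Var vK)) B (t_level K \<beta> c B Tc)) (invar NL)" if "invar 0 s" for s
  proof (rule runs_loop[where I = invar and N = NL])
    show "invar 0 s" by (rule that)
    show "runs \<Omega> (level_body K \<beta> c) s (t_level K \<beta> c B Tc) (invar (Suc k))"
      if "invar k s" "k < NL" for k s
      using runs_level_body that by blast
    show "reads_fit B (Sub (Var vLevels) (Var vK)) s \<and> (aval (Sub (Var vLevels) (Var vK)) s \<noteq> 0 \<longleftrightarrow> k < NL)"
      if "invar k s" "k \<le> NL" for k s
      using that Bs by (auto simp: invar_def globals_def)
  qed (use Bs in auto)
  have out: "output_family s' \<in> augmented_allocations \<beta> n m \<and>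
      optimal_utility n m u / \<alpha> \<le> min_utility n u (output_family s')"
    if inv: "invar NL s" and s': "\<forall>j<n. s' j = row s R (s vBest) j" for s s'
  proof -
    have eq: "output_family s' j = best s j" if "j < n" for j
      using s' that by (simp add: output_family_def best_def)
    have "output_family s' \<in> augmented_allocations \<beta> n m"
      using inv eq by (auto simp: invar_def augmented_allocations_def Pi_def cong: conj_cong)
    moreover have "min_utility n u (output_family s') = min_utility n u (best s)"
      unfolding min_utility_def by (simp add: eq cong: image_cong_simp)
    moreover have "opt / \<alpha> \<le> ratio (s vBP, s vBQ)"
    proof (cases "0 < opt")
      case True
      then show ?thesis using exists_good inv by (auto simp: invar_def)
    next
      \<comment> \<open>No level is good then, but the initial bound 0 already suffices.\<close>
      case False
      then have "opt / \<alpha> \<le> 0" using \<alpha>(1) by (simp add: divide_le_0_iff)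
      also have "0 \<le> ratio (s vBP, s vBQ)" by (simp add: ratio_def)
      finally show ?thesis .
    qed
    ultimately show ?thesis using inv by (simp add: invar_def opt_def)
  qed
  show "runs \<Omega> (prepare K ;; While (Sub (Var vL) (Var vJ)) (power_body K) ;;
      While (Sub (Var vLevels) (Var vK)) (level_body K \<beta> c) ;; write_output) (initial_memory n m b)
    (1 + t_block (prepare K) B +
     (1 + t_loop (Sub (Var vL) (Var vJ)) B (t_block (power_body K) B) +
     (1 + t_loop (Sub (Var vLevels) (Var vK)) B (t_level K \<beta> c B Tc) +
     (1 + t_block (Set 0 (Var vN) ;; Set 1 (Var vR) ;; Set 2 (Var vBest)) B +
     (1 + t_loop (Sub (Var 0) (Const 3)) B (t_block output_body B) +
      t_block (Set 0 (Add (Add (Const 40) (Var 1)) (Var 2)) ;; Set 1 (Add (Var 1) (Var 0)) ;;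
        Set 2 (Sub (Add (Var 1) (Var 1)) (Var 0)) ;;
        Set 0 (Mem (Var 0)) ;; Set 1 (Mem (Var 1)) ;; Set 2 (Mem (Var 2))) B)))))
    (\<lambda>s. output_family s \<in> augmented_allocations \<beta> n m \<and>
      optimal_utility n m u / \<alpha> \<le> min_utility n u (output_family s))"
    by (rule runs_Seq[OF runs_prepare], erule runs_Seq[OF runs_power_loop], erule runs_Seq[OF loop])
      (rule runs_mono[OF runs_write_output], assumption, rule order_refl, erule (1) out)
qed (use m Bs in \<open>auto simp: initial_memory_def\<close>)

end

section \<open>Polynomial running time\<close>

definition is_poly :: "(nat \<Rightarrow> nat) \<Rightarrow> bool" where
  "is_poly f \<longleftrightarrow> (\<exists>p :: nat poly. \<forall>x. f x = poly p x)"

lemma is_poly_const: "is_poly (\<lambda>x. k)"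
  unfolding is_poly_def by (rule exI[of _ "[:k:]"]) simp

lemma is_poly_id: "is_poly (\<lambda>x. x)"
  unfolding is_poly_def by (rule exI[of _ "[:0, 1:]"]) simp

lemma is_poly_add: "is_poly f \<Longrightarrow> is_poly g \<Longrightarrow> is_poly (\<lambda>x. f x + g x)"
  unfolding is_poly_def by (metis poly_add)

lemma is_poly_mult: "is_poly f \<Longrightarrow> is_poly g \<Longrightarrow> is_poly (\<lambda>x. f x * g x)"
  unfolding is_poly_def by (metis poly_mult)

lemma is_poly_poly: "is_poly f \<Longrightarrow> is_poly (\<lambda>x. poly p (f x))"
  unfolding is_poly_def by (metis poly_pcompose)

lemmas is_poly_intros = is_poly_const is_poly_id is_poly_add is_poly_mult is_poly_poly

text \<open>The coefficients are natural numbers. This turns the time bound for the simulated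
  instances, whose size is at most B, into one that depends on B only.\<close>

lemma poly_nat_mono: "x \<le> y \<Longrightarrow> poly (p :: nat poly) x \<le> poly p y"
  by (induction p) (auto intro: add_mono mult_mono)

lemma is_poly_t_main:
  assumes "is_poly B" "is_poly Tc"
  shows "is_poly (\<lambda>x. t_main K \<beta> c (B x) (Tc x))"
  unfolding t_main_def t_level_def t_item_def t_loop_def t_block_def
  by (intro is_poly_intros assms)

text \<open>The inequality amounts to \<alpha> \<le> K * (\<beta> + 1 - \<alpha>), so any large K
  will do, as \<alpha> lies strictly below \<beta> + 1; taking a successor guarantees K \<ge>
  1.\<close>

lemma exists_ratio_bound:
  fixes \<alpha> :: real
  assumes "\<alpha> < real \<beta> + 1"
  shows "\<exists>K\<ge>1. \<alpha> * (real K + 1) \<le> (real \<beta> + 1) * real K"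
proof -
  obtain K where K: "\<alpha> / (real \<beta> + 1 - \<alpha>) \<le> real K" using real_arch_simple by blast
  have pos: "0 < real \<beta> + 1 - \<alpha>" using assms by simp
  have "\<alpha> / (real \<beta> + 1 - \<alpha>) \<le> real (K + 1)" using K by simp
  then have "\<alpha> \<le> real (K + 1) * (real \<beta> + 1 - \<alpha>)" using pos by (simp add: pos_divide_le_eq)
  then have "\<alpha> * (real (K + 1) + 1) \<le> (real \<beta> + 1) * real (K + 1)" by (simp add: algebra_simps)
  then show ?thesis by (intro exI[of _ "K + 1"]) simp
qed

section \<open>Truncated instances, and the case without items\<close>

context reduction
begin

text \<open>Here closure under truncation enters. A truncated value is an old value or the level,
  hence rational and of bounded length.\<close>

lemma is_instance_speeds:
  assumes C: "closed_under_truncation C" and inst: "is_instance C n m b u" and k: "k < NL"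
  shows "is_instance C (rank u (ratio (V k)) n) m (b + 2 * (K + 1) * (L + 1)) (speeds n u (ratio (V k)))"
  unfolding is_instance_def
proof (intro allI impI conjI)
  fix i assume i: "i < rank u (ratio (V k)) n"
  let ?j = "active_list u (ratio (V k)) n ! i"
  have j: "?j < n" using active_list_nth(1)[OF i] .
  note lp = level_props[OF k]
  show "speeds n u (ratio (V k)) i \<in> C m"
    using C inst j lp(3) by (simp add: speeds_def closed_under_truncation_def is_instance_def)
  fix S :: "nat set" assume S: "S \<subseteq> {..<m}"
  show "speeds n u (ratio (V k)) i S \<in> \<rat>" "encoding_length (speeds n u (ratio (V k)) i S) \<le> b + 2 * (K + 1) * (L + 1)"
    using u[OF j S] lp(4,7) by (auto simp: speeds_def truncation_def min_def)
qed

end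

lemma runs_mmfa_program_no_items:
  assumes "40 \<le> B"
  shows "runs \<Omega> (mmfa_program K \<beta> c) (initial_memory n 0 b)
    (1 + aweight (Var 1) * (B + 1) + t_block (Set 0 (Const 0) ;; Set 2 (Const 0)) B) (\<lambda>s. s = (\<lambda>_. 0))"
proof -
  let ?s = "initial_memory n 0 b" and ?c = "Set 0 (Const 0) ;; Set 2 (Const 0)"
  have "runs \<Omega> ?c ?s (t_block ?c B) (\<lambda>s. s = (\<lambda>_. 0))"
    using assms by (intro runs_block) (auto simp: initial_memory_def fun_eq_iff)
  then obtain t s' where 1: "exec \<Omega> ?c ?s t s'" "t \<le> t_block ?c B" "s' = (\<lambda>_. 0)"
    unfolding runs_def by blast
  have 0: "aval (Var 1) ?s = 0" "reads_fit B (Var 1) ?s"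
    using assms by (simp_all add: initial_memory_def)
  have "1 + acost (Var 1) ?s + t \<le> 1 + aweight (Var 1) * (B + 1) + t_block ?c B"
    using acost_le[OF 0(2)] assms 1(2) by linarith
  then show ?thesis
    unfolding mmfa_program_def by (rule runsI[OF exec.IfFalse[OF 0(1) 1(1)]]) (rule 1(3))
qed

text \<open>Without items every allocation gives the agents empty sets, so this one is optimal;
  dividing by \<alpha> \<ge> 1 does not increase a nonnegative value.\<close>

lemma no_items_optimal:
  assumes n: "0 < n" and \<alpha>: "1 \<le> \<alpha>" and u: "\<And>j. j < n \<Longrightarrow> 0 \<le> u j {}"
  shows "(\<lambda>_. {}) \<in> augmented_allocations \<beta> n 0"
    and "optimal_utility n 0 u / \<alpha> \<le> min_utility n u (\<lambda>_. {})"
proof -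
  show "(\<lambda>_. {}) \<in> augmented_allocations \<beta> n 0" by (simp add: augmented_allocations_def)
  obtain T where T: "T \<in> allocations n 0" "min_utility n u T = optimal_utility n 0 u"
    using optimal_utility_attained[OF n] by metis
  have "T j = {}" if "j < n" for j using T(1) that by (auto simp: augmented_allocations_def)
  then have eq: "optimal_utility n 0 u = min_utility n u (\<lambda>_. {})"
    unfolding T(2)[symmetric] min_utility_def by (simp cong: image_cong_simp)
  have "0 \<le> min_utility n u (\<lambda>_. {})" unfolding min_utility_ge_iff[OF n] using u by simp
  then have "min_utility n u (\<lambda>_. {}) * 1 \<le> min_utility n u (\<lambda>_. {}) * \<alpha>"
    using \<alpha> by (intro mult_left_mono) auto
  then show "optimal_utility n 0 u / \<alpha> \<le> min_utility n u (\<lambda>_. {})"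
    unfolding eq using \<alpha> by (simp add: divide_le_eq)
qed

theorem theorem3:
  fixes C :: "nat \<Rightarrow> (nat set \<Rightarrow> real) set" and \<alpha> :: real
  assumes "nonneg_class C"
    and "closed_under_truncation C"
    and "1 \<le> \<alpha>"
    and "\<exists>c. assignment_approx_algorithm C \<alpha> c"
  shows "\<exists>c. mmfa_augmented_approx_algorithm C (nat \<lfloor>\<alpha>\<rfloor>) \<alpha> c"
proof -
  define \<beta> where "\<beta> = nat \<lfloor>\<alpha>\<rfloor>"
  have "\<alpha> < real \<beta> + 1" using assms(3) unfolding \<beta>_def by linarith
  then obtain K where K\<alpha>: "1 \<le> K" "\<alpha> * (real K + 1) \<le> (real \<beta> + 1) * real K"
    using exists_ratio_bound by blast
  obtain c and p :: "nat poly" where c: "\<And>n m b g. 0 < m \<Longrightarrow> is_instance C n m b g \<Longrightarrow>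
      \<exists>t s. exec (value_oracle n m g) c (initial_memory n m b) t s \<and> t \<le> poly p (n + m + b) \<and>
        output_family s \<in> assignments n m \<and>
        load n m g (output_family s) \<le> ennreal \<alpha> * optimal_load n m g"
    using assms(4) unfolding assignment_approx_algorithm_def by metis
  \<comment> \<open>The lower bound required in \<open>reduction\<close>, read as a polynomial in
    the size n + m + b.\<close>
  define B where "B = (\<lambda>x. 100 + 8 * (K + 1) * (K + 1) * (x + 1) + \<beta>)"
  \<comment> \<open>The sum covers both branches of the program.\<close>
  define T where "T = (\<lambda>x. t_main K \<beta> c (B x) (poly p (B x)) +
    (1 + aweight (Var 1) * (B x + 1) + t_block (Set 0 (Const 0) ;; Set 2 (Const 0)) (B x)))"
  have "is_poly T"
    unfolding T_def B_def t_block_def by (intro is_poly_intros is_poly_t_main)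
  then obtain q where q: "\<And>x. T x = poly q x" unfolding is_poly_def by blast
  have "\<exists>t s. exec (value_oracle n m u) (mmfa_program K \<beta> c) (initial_memory n m b) t s \<and>
      t \<le> poly q (n + m + b) \<and> output_family s \<in> augmented_allocations \<beta> n m \<and>
      optimal_utility n m u / \<alpha> \<le> min_utility n u (output_family s)"
    if n: "0 < n" and inst: "is_instance C n m b u" for n m b u
  proof -
    have u: "u j S \<in> \<rat> \<and> 0 \<le> u j S \<and> encoding_length (u j S) \<le> b" if "j < n" "S \<subseteq> {..<m}" for j S
      using inst assms(1) that unfolding is_instance_def nonneg_class_def by blast
    let ?good = "\<lambda>s. output_family s \<in> augmented_allocations \<beta> n m \<and>
      optimal_utility n m u / \<alpha> \<le> min_utility n u (output_family s)"
    let ?B = "B (n + m + b)"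
    have "runs (value_oracle n m u) (mmfa_program K \<beta> c) (initial_memory n m b) (T (n + m + b)) ?good"
    proof (cases "m = 0")
      case True
      have "40 \<le> ?B" by (simp add: B_def)
      from runs_mmfa_program_no_items[OF this, of "value_oracle n m u" K \<beta> c n b]
      show ?thesis unfolding True
      proof (rule runs_mono)
        fix s :: memory assume "s = (\<lambda>_. 0)"
        then have "output_family s = (\<lambda>_. {})" by (simp add: output_family_def)
        then show "output_family s \<in> augmented_allocations \<beta> n 0 \<and>
            optimal_utility n 0 u / \<alpha> \<le> min_utility n u (output_family s)"
          using no_items_optimal[OF n assms(3), of u] u by simp
      qed (simp add: T_def True)
    next
      case False
      interpret reduction n m b K \<beta> ?B u
        by unfold_locales (use n False K\<alpha> u in \<open>auto simp: B_def\<close>)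
      interpret reduction_run n m b K \<beta> ?B u c "poly p ?B" \<alpha>
      proof unfold_locales
        fix k assume k: "k < NL"
        let ?n = "rank u (ratio (V k)) n" and ?b = "b + 2 * (K + 1) * (L + 1)"
        \<comment> \<open>Removing agents only shrinks the instance, and the larger length bound is
          accounted for in B; so the time of each simulated run is polynomial in the original
          size.\<close>
        have "?n + m + ?b \<le> ?B"
          using rank_le[of u "ratio (V k)" n] B_bounds(13) by linarith
        then have "poly p (?n + m + ?b) \<le> poly p ?B" by (rule poly_nat_mono)
        then show "\<exists>t v. exec (job_oracle k) c (initial_memory ?n m ?b) t v \<and> t \<le> poly p ?B \<and>
            output_family v \<in> assignments ?n m \<and>
            load ?n m (speeds n u (ratio (V k))) (output_family v) \<le>
              ennreal \<alpha> * optimal_load ?n m (speeds n u (ratio (V k)))"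
          using c[OF m is_instance_speeds[OF assms(2) inst k]] unfolding job_oracle_def
          by (meson order_trans)
      qed (use assms(3) K\<alpha> in auto)
      show ?thesis by (rule runs_mono[OF runs_mmfa_program]) (simp_all add: T_def)
    qed
    then show ?thesis unfolding runs_def q .
  qed
  then have "mmfa_augmented_approx_algorithm C \<beta> \<alpha> (mmfa_program K \<beta> c)"
    unfolding mmfa_augmented_approx_algorithm_def by blast
  then show ?thesis unfolding \<beta>_def by blast
qed

end
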